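(* Assume $P_{ij}>0$ and $Q_{ii}>0$ for all $i,j=1,\dots,r$. Let $\big(e(t),f(t),u(t)\big)$ be the unique solution of the fluid model with initial condition $(e(0),f(0))\in\mathcal{T}$. Then for any $\epsilon>0$ there exists $T>0$ such that $$\inf_{x\in\mathcal{E}}\big|\big(e(t),f(t)\big)-x\big|<\epsilon,\qquad t\ge T.$$
   Context: Fix an integer $r\ge1$, reals $\lambda_i>0$, $\mu_{ij}>0$ ($1\le i,j\le r$), and $r\times r$ row-stochastic matrices $P=(P_{ij})$ and $Q=(Q_{ij})$. Let $$\mathcal{T}=\Big\{(e,f)\in[0,1]^{r\times r}\times[0,1]^{r\times r}:\ \sum_{i,j}(e_{ij}+f_{ij})=1\Big\},$$ and let $|\cdot|$ denote the max-norm. Fluid model: given $(e(0),f(0))\in\mathcal{T}$, there is a unique (càdlàg, in fact Lipschitz continuous) solution $(e,f):\mathbb{R}_+\to\mathcal{T}$, $u:\mathbb{R}_+\to\mathbb{R}_+^r$ of the system, for all $t\ge0$, $f_{ij}(t)=f_{ij}(0)+\lambda_iP_{ij}(t-u_i(t))-\mu_{ij}\int_0^tf_{ij}(s)ds$ for $1\le i,j\le r$; $e_{ij}(t)=e_{ij}(0)-\mu_{ij}\int_0^te_{ij}(s)ds+Q_{ij}\sum_{k=1}^r\mu_{ki}\int_0^tf_{ki}(s)ds$ for $1\le i\ne j\le r$; $e_{ii}(t)=e_{ii}(0)-\lambda_i(t-u_i(t))+\sum_{j\ne i}\mu_{ji}\int_0^te_{ji}(s)ds+Q_{ii}\sum_{j=1}^r\mu_{ji}\int_0^tf_{ji}(s)ds$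 for $1\le i\le r$; $u$ is componentwise non-decreasing with $u(0)=0$, and $\int_0^\infty e_{ii}(s)\,du_i(s)=0$ for all $1\le i\le r$. Equilibrium set: $\mathcal{E}$ is the set of $(\bar e,\bar f)\in\mathcal{T}$ for which there exists $\bar a\in[0,1]^r$ such that $\lambda_iP_{ij}\bar a_i=\mu_{ij}\bar f_{ij}$ for $1\le i,j\le r$; $\mu_{ij}\bar e_{ij}=Q_{ij}\sum_{k=1}^r\mu_{ki}\bar f_{ki}$ for $1\le i\ne j\le r$; $\lambda_i\bar a_i=\sum_{k\ne i}\mu_{ki}\bar e_{ki}+Q_{ii}\sum_{k=1}^r\mu_{ki}\bar f_{ki}$ for $1\le i\le r$; $(1-\bar a_i)\bar e_{ii}=0$ for $1\le i\le r$. *)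

theory Defs
  imports "HOL-Analysis.Analysis"
begin

text \<open>
  The index set of size \<open>r \<ge> 1\<close> is an arbitrary type \<open>'r\<close> of class \<open>finite\<close>; a state is a pair
  \<open>(e, f)\<close> of \<open>r \<times> r\<close> matrices. On the type of states the library's \<open>infnorm\<close> is the maximum of
  the absolute values of all entries of \<open>e\<close> and \<open>f\<close>, since these are the coordinates with
  respect to \<open>Basis\<close>.
\<close>

type_synonym 'r state = "(real^'r^'r) \<times> (real^'r^'r)"

definition row_stochastic :: "real^'r^'r \<Rightarrow> bool" where
  "row_stochastic M \<longleftrightarrow> (\<forall>i j. 0 \<le> M $ i $ j) \<and> (\<forall>i. (\<Sum>j\<in>UNIV. M $ i $ j) = 1)"

definition state_space :: "('r::finite) state set" where
  "state_space = {(e, f).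
     (\<forall>i j. 0 \<le> e $ i $ j \<and> e $ i $ j \<le> 1) \<and>
     (\<forall>i j. 0 \<le> f $ i $ j \<and> f $ i $ j \<le> 1) \<and>
     (\<Sum>i\<in>UNIV. \<Sum>j\<in>UNIV. e $ i $ j + f $ i $ j) = 1}"

text \<open>Paths on \<open>[0, \<infinity>)\<close> are functions on \<open>real\<close> whose values at negative times are irrelevant.\<close>

definition cadlag :: "(real \<Rightarrow> 'b::topological_space) \<Rightarrow> bool" where
  "cadlag x \<longleftrightarrow>
     (\<forall>t\<ge>0. (x \<longlongrightarrow> x t) (at_right t)) \<and>
     (\<forall>t>0. \<exists>l. (x \<longlongrightarrow> l) (at_left t))"

text \<open>
  The condition \<open>\<integral>\<^sub>0\<^sup>\<infinity> e\<^sub>i\<^sub>i du\<^sub>i = 0\<close> is a Lebesgue-Stieltjes integral of a nonnegative function.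
  As \<open>interval_measure\<close> expects a nondecreasing right-continuous function on all of \<open>real\<close>,
  \<open>u\<^sub>i\<close> is extended by \<open>u\<^sub>i(0) = 0\<close> to negative times, so that no mass is put on \<open>(-\<infinity>, 0]\<close>.
\<close>

definition fluid_solution ::
  "real^'r \<Rightarrow> real^'r^'r \<Rightarrow> real^'r^'r \<Rightarrow> real^'r^'r \<Rightarrow>
   (real \<Rightarrow> real^'r^'r) \<Rightarrow> (real \<Rightarrow> real^'r^'r) \<Rightarrow> (real \<Rightarrow> real^('r::finite)) \<Rightarrow> bool" where
  "fluid_solution lam mu P Q e f u \<longleftrightarrow>
     cadlag e \<and> cadlag f \<and> cadlag u \<and>
     (\<forall>t\<ge>0. (e t, f t) \<in> state_space) \<and>
     (\<forall>t\<ge>0. \<forall>i. 0 \<le> u t $ i) \<and>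
     (\<forall>t\<ge>0. \<forall>i j.
        f t $ i $ j = f 0 $ i $ j + lam $ i * P $ i $ j * (t - u t $ i)
          - mu $ i $ j * integral {0..t} (\<lambda>s. f s $ i $ j)) \<and>
     (\<forall>t\<ge>0. \<forall>i j. i \<noteq> j \<longrightarrow>
        e t $ i $ j = e 0 $ i $ j - mu $ i $ j * integral {0..t} (\<lambda>s. e s $ i $ j)
          + Q $ i $ j * (\<Sum>k\<in>UNIV. mu $ k $ i * integral {0..t} (\<lambda>s. f s $ k $ i))) \<and>
     (\<forall>t\<ge>0. \<forall>i.
        e t $ i $ i = e 0 $ i $ i - lam $ i * (t - u t $ i)
          + (\<Sum>j\<in>UNIV - {i}. mu $ j $ i * integral {0..t} (\<lambda>s. e s $ j $ i))
          + Q $ i $ i * (\<Sum>j\<in>UNIV. mu $ j $ i * integral {0..t} (\<lambda>s. f s $ j $ i))) \<and>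
     (\<forall>i. mono_on {0..} (\<lambda>t. u t $ i)) \<and>
     u 0 = 0 \<and>
     (\<forall>i. (\<integral>\<^sup>+ s\<in>{0..}. ennreal (e s $ i $ i)
             \<partial>interval_measure (\<lambda>s. u (max 0 s) $ i)) = 0)"

definition equilibrium_set ::
  "real^'r \<Rightarrow> real^'r^'r \<Rightarrow> real^'r^'r \<Rightarrow> real^'r^'r \<Rightarrow> ('r::finite) state set" where
  "equilibrium_set lam mu P Q = {(e, f). (e, f) \<in> state_space \<and>
     (\<exists>a :: real^'r.
        (\<forall>i. 0 \<le> a $ i \<and> a $ i \<le> 1) \<and>
        (\<forall>i j. lam $ i * P $ i $ j * a $ i = mu $ i $ j * f $ i $ j) \<and>
        (\<forall>i j. i \<noteq> j \<longrightarrow>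
           mu $ i $ j * e $ i $ j = Q $ i $ j * (\<Sum>k\<in>UNIV. mu $ k $ i * f $ k $ i)) \<and>
        (\<forall>i. lam $ i * a $ i =
           (\<Sum>k\<in>UNIV - {i}. mu $ k $ i * e $ k $ i)
             + Q $ i $ i * (\<Sum>k\<in>UNIV. mu $ k $ i * f $ k $ i)) \<and>
        (\<forall>i. (1 - a $ i) * e $ i $ i = 0))}"

end

theory Submission
  imports Defs
begin

text \<open>
  Write \<open>X\<^sub>i(t) = \<lambda>\<^sub>i (t - u\<^sub>i(t))\<close> for the cumulative flow of departing customers. Let \<open>x\<close> be the
  stationary row vector of \<open>PQ\<close>, scaled so that \<open>x\<^sub>i \<le> \<lambda>\<^sub>i\<close> with equality somewhere, and let
  \<open>f\<^sup>*, e\<^sup>*\<close> be the transit loads carried by the flow \<open>x\<close>, of total mass \<open>F\<close>. The inequalities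
  \<open>f \<ge> k f\<^sup>*, e \<ge> k e\<^sup>*\<close> off the diagonal persist for every level \<open>k \<le> 1\<close>. For
  \<open>c = min 1 (1/F)\<close>, a level \<open>k < c\<close> always leaves a surplus of mass of order \<open>c - k\<close> somewhere, and
  positivity of \<open>P\<close> and of the diagonal of \<open>Q\<close> spreads it everywhere, so the level approaches \<open>c\<close>
  exponentially fast. If \<open>F \<ge> 1\<close>, mass conservation then forces convergence. If \<open>F < 1\<close>, a queue at a
  bottleneck (\<open>x\<^sub>i = \<lambda>\<^sub>i\<close>) bounds the accumulated excess of the flow into it, so all excesses are
  integrable and vanish in the limit. Every limit point of \<open>(e, f)\<close> is therefore an equilibrium, with
  \<open>a\<^sub>i = c x\<^sub>i / \<lambda>\<^sub>i\<close>.
\<close>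

subsection \<open>Auxiliary analysis and linear algebra\<close>

text \<open>The equilibrium need not be unique: if \<open>F < 1\<close> and several stations satisfy
  \<open>x i = lam i\<close>, the spare mass \<open>1 - F\<close> can be split among their queues
  arbitrarily. In that case these queues are not shown to converge; only the loads in transit and
  the other queues are, and compactness turns this into a statement about the distance to the set.
  The two arguments of \<open>c\<close> are the two obstacles to a higher level: beyond 1 a station
  with \<open>x i = lam i\<close> would have to serve faster than \<open>lam i\<close>, and beyond
  \<open>1 / F\<close> the transit loads would need more than the total mass. Persistence of a level
  is circular, since the inflow that sustains one compartment depends on the level of the others
  over the same time window. It is resolved by bootstrapping from the level 0, which always holds.
  Paths are only assumed cadlag and the equations are integrated, so continuity of \<open>u\<close>
  has to be extracted from the complementarity integral first; afterwards the estimates compare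
  increments over windows.\<close>

lemma integral_lower_bound:
  fixes g :: "real \<Rightarrow> real"
  assumes "s \<le> t" "continuous_on {s..t} g" "\<And>r. r \<in> {s..t} \<Longrightarrow> a \<le> g r"
  shows "a * (t - s) \<le> integral {s..t} g"
proof -
  have "integral {s..t} (\<lambda>_. a) \<le> integral {s..t} g"
    using assms by (intro integral_le integrable_continuous_real continuous_intros) auto
  then show ?thesis
    using assms(1) by (simp add: mult.commute)
qed

text \<open>Integrated form of \<open>x' = I' - m x\<close>, with \<open>I\<close> not assumed
  differentiable. For the surplus \<open>S r = I r - m * k * r\<close>, \<open>low\<close> says that
  \<open>S\<close> never exceeds \<open>S t\<close> on the window; hence \<open>S t - S s\<close>
  counts at least as if it had all arrived at \<open>s\<close> and decayed at rate \<open>m\<close>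
  since.\<close>

lemma relax_lower_bound:
  fixes x I :: "real \<Rightarrow> real"
  assumes m: "m > 0" and st: "s \<le> t" and cont: "continuous_on {s..t} x"
    and eq: "\<And>r. r \<in> {s..t} \<Longrightarrow> x r = x s + (I r - I s) - m * integral {s..r} x"
    and low: "\<And>r. r \<in> {s..t} \<Longrightarrow> I t - I r \<ge> m * k * (t - r)"
  shows "x t - k \<ge> exp (- m * (t - s)) * (x s - k + (I t - I s - m * k * (t - s)))"
proof -
  define B where "B = x s - k + (I t - I s - m * k * (t - s))"
  define z where "z r = integral {s..r} x - k * (r - s)" for r
  \<comment> \<open>The integrating factor acts on the primitive of \<open>x - k\<close>, which is
    differentiable although \<open>x\<close> need not be.\<close>
  define v where "v r = exp (m * (r - s)) * (m * z r - B)" for r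
  have "v s \<ge> v t"
  proof (rule DERIV_nonpos_imp_decreasing_open[OF st])
    show "continuous_on {s..t} v"
      unfolding v_def z_def
      by (intro continuous_intros indefinite_integral_continuous_1 integrable_continuous_real cont)
    fix r assume r: "s < r" "r < t"
    have "((\<lambda>r. integral {s..r} x) has_real_derivative x r) (at r within {s..t})"
      using cont r by (intro integral_has_real_derivative) auto
    then have *: "((\<lambda>r. integral {s..r} x) has_real_derivative x r) (at r)"
      using r by (simp add: at_within_Icc_at)
    have "(v has_real_derivative exp (m * (r - s)) * m * ((x r - k) + (m * z r - B))) (at r)"
      unfolding v_def z_def
      by (rule derivative_eq_intros * refl)+ (simp add: algebra_simps)
    moreover have "(x r - k) + (m * z r - B) \<le> 0"
      using eq[of r] low[of r] r unfolding B_def z_def by (simp add: algebra_simps)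
    ultimately show "\<exists>y. DERIV v r :> y \<and> y \<le> 0"
      using m by (metis exp_ge_zero less_eq_real_def mult_nonneg_nonneg mult_nonneg_nonpos)
  qed
  then have "exp (m * (t - s)) * (m * z t - B) \<le> - B"
    by (simp add: v_def z_def)
  then have "exp (- m * (t - s)) * (exp (m * (t - s)) * (m * z t - B)) \<le> exp (- m * (t - s)) * (- B)"
    by (intro mult_left_mono) auto
  then have "m * z t - B \<le> - (exp (- m * (t - s)) * B)"
    by (simp flip: mult.assoc exp_add)
  moreover have "x t - k = B - m * z t"
    using eq[of t] st unfolding B_def z_def by (simp add: algebra_simps)
  ultimately show ?thesis
    unfolding B_def by linarith
qed

lemma integral_ge_exp:
  fixes g :: "real \<Rightarrow> real"
  assumes "s \<le> t" "continuous_on {s..t} g" "0 < \<gamma>"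
    and low: "\<And>r. r \<in> {s..t} \<Longrightarrow> a - b * exp (- \<gamma> * r) \<le> g r"
  shows "a * (t - s) + b / \<gamma> * (exp (- \<gamma> * t) - exp (- \<gamma> * s)) \<le> integral {s..t} g"
proof -
  let ?p = "\<lambda>r. a * r + b / \<gamma> * exp (- \<gamma> * r)"
  have "((\<lambda>r. a - b * exp (- \<gamma> * r)) has_integral ?p t - ?p s) {s..t}"
  proof (rule fundamental_theorem_of_calculus[OF assms(1)])
    fix r assume "r \<in> {s..t}"
    have "(?p has_real_derivative a - b * exp (- \<gamma> * r)) (at r within {s..t})"
      using assms(3) by (auto intro!: derivative_eq_intros)
    then show "(?p has_vector_derivative a - b * exp (- \<gamma> * r)) (at r within {s..t})"
      by (simp add: has_real_derivative_iff_has_vector_derivative)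
  qed
  then have "?p t - ?p s \<le> integral {s..t} g"
    using assms(2) low by (intro has_integral_le[OF _ integrable_integral] integrable_continuous_real) auto
  then show ?thesis by (simp add: algebra_simps)
qed

lemma tendsto_exp_decay:
  fixes \<gamma> :: real
  assumes "0 < \<gamma>"
  shows "((\<lambda>t. exp (- \<gamma> * t)) \<longlongrightarrow> 0) at_top"
  using assms
  by (intro filterlim_compose[OF exp_at_bot]
      filterlim_tendsto_neg_mult_at_bot[OF tendsto_const _ filterlim_ident]) auto

text \<open>
  Barbalat: the primitive of \<open>g + D exp (- \<gamma> t)\<close> is monotone and bounded, hence Cauchy, while a
  value \<open>g t \<ge> \<eta>\<close> makes it grow by a fixed amount on an interval after \<open>t\<close>.
\<close>

lemma integral_bounded_imp_tendsto_0:
  fixes g :: "real \<Rightarrow> real"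
  assumes lip: "\<And>s t. 0 \<le> s \<Longrightarrow> s \<le> t \<Longrightarrow> \<bar>g t - g s\<bar> \<le> L * (t - s)"
    and "\<gamma> > 0" "D \<ge> 0"
    and low: "\<And>t. 0 \<le> t \<Longrightarrow> - (D * exp (- \<gamma> * t)) \<le> g t"
    and bdd: "\<And>t. 0 \<le> t \<Longrightarrow> integral {0..t} g \<le> K"
  shows "(g \<longlongrightarrow> 0) at_top"
proof -
  have cont: "continuous_on {0..} g"
  proof (rule continuous_on_subset[OF lipschitz_on_continuous_on[OF lipschitz_onI]])
    show "0 \<le> max L 0" by simp
    show "dist (g x) (g y) \<le> max L 0 * dist x y" if "x \<in> {0..}" "y \<in> {0..}" for x y
    proof (cases "x \<le> y")
      case True
      then have "\<bar>g y - g x\<bar> \<le> L * (y - x)" using lip that by simp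
      also have "\<dots> \<le> max L 0 * (y - x)" using True by (intro mult_right_mono) auto
      finally show ?thesis using True by (simp add: dist_real_def abs_minus_commute)
    next
      case False
      then have "\<bar>g x - g y\<bar> \<le> L * (x - y)" using lip that by simp
      also have "\<dots> \<le> max L 0 * (x - y)" using False by (intro mult_right_mono) auto
      finally show ?thesis using False by (simp add: dist_real_def)
    qed
  qed auto
  have int: "g integrable_on {a..b}" if "0 \<le> a" for a b
    using that by (intro integrable_continuous_real continuous_on_subset[OF cont]) auto
  define N where "N t = integral {0..t} g - D / \<gamma> * exp (- \<gamma> * t)" for t
  have step: "integral {s..t} g \<le> N t - N s"
    if "0 \<le> s" "s \<le> t" for s t
  proof -
    have "integral {0..s} g + integral {s..t} g = integral {0..t} g"
      using that int by (intro Henstock_Kurzweil_Integration.integral_combine) auto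
    moreover have "D / \<gamma> * exp (- \<gamma> * t) \<le> D / \<gamma> * exp (- \<gamma> * s)"
      using assms(2,3) that by (intro mult_left_mono) auto
    ultimately show ?thesis
      unfolding N_def by linarith
  qed
  have mono: "N s \<le> N t" if "0 \<le> s" "s \<le> t" for s t
  proof -
    have "0 * (t - s) + D / \<gamma> * (exp (- \<gamma> * t) - exp (- \<gamma> * s)) \<le> integral {s..t} g"
      using that assms(2) low by (intro integral_ge_exp continuous_on_subset[OF cont]) auto
    moreover have "integral {0..s} g + integral {s..t} g = integral {0..t} g"
      using that int by (intro Henstock_Kurzweil_Integration.integral_combine) auto
    ultimately show ?thesis
      unfolding N_def right_diff_distrib by linarith
  qed
  define S where "S = (SUP t\<in>{0..}. N t)"
  have NK: "N t \<le> K" if "0 \<le> t" for t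
    using bdd[OF that] assms(2,3) unfolding N_def by (smt (verit) divide_nonneg_pos exp_ge_zero mult_nonneg_nonneg)
  have bddN: "bdd_above (N ` {0..})"
    using NK by (auto intro!: bdd_aboveI)
  have NS: "N t \<le> S" if "0 \<le> t" for t
    unfolding S_def using that bddN by (intro cSUP_upper) auto
  show ?thesis
  proof (rule order_tendstoI)
    fix a :: real assume "a < 0"
    have "((\<lambda>t. - (D * exp (- \<gamma> * t))) \<longlongrightarrow> - (D * 0)) at_top"
      by (intro tendsto_intros tendsto_exp_decay assms(2))
    then have "eventually (\<lambda>t. - (D * exp (- \<gamma> * t)) > a) at_top"
      using \<open>a < 0\<close> by (simp add: order_tendstoD)
    then show "eventually (\<lambda>t. g t > a) at_top"
      using eventually_ge_at_top[of 0] by eventually_elim (use low in force)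
  next
    fix \<eta> :: real assume eta: "\<eta> > 0"
    \<comment> \<open>A value \<open>g t \<ge> \<eta>\<close> stays above \<open>\<eta> / 2\<close>
      for time \<open>h\<close>, which adds \<open>h * \<eta> / 2\<close> to \<open>N\<close>, while
      less than \<open>h * \<eta> / 4\<close> is left to gain after \<open>t0\<close>. The
      \<open>max\<close> keeps the divisor positive.\<close>
    define M where "M = max L 1"
    define h where "h = \<eta> / (2 * M)"
    have M: "M \<ge> 1" "L \<le> M" and h: "h > 0" using eta by (auto simp: M_def h_def)
    have "S - h * \<eta> / 4 < S" using h eta by simp
    then obtain t0 where t0: "t0 \<ge> 0" "N t0 > S - h * \<eta> / 4"
      unfolding S_def using less_cSUP_iff[OF _ bddN] by auto
    show "eventually (\<lambda>t. g t < \<eta>) at_top"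
      using eventually_ge_at_top[of t0]
    proof eventually_elim
      case (elim t)
      show ?case
      proof (rule ccontr)
        assume "\<not> g t < \<eta>"
        then have g: "g r \<ge> \<eta> / 2" if "r \<in> {t..t+h}" for r
        proof -
          have "\<bar>g r - g t\<bar> \<le> L * (r - t)" using lip t0 elim that by auto
          also have "\<dots> \<le> M * (r - t)" using M that by (intro mult_right_mono) auto
          also have "\<dots> \<le> M * h" using M that by (intro mult_left_mono) auto
          also have "\<dots> = \<eta> / 2" using M by (simp add: h_def)
          finally show ?thesis using \<open>\<not> g t < \<eta>\<close> by linarith
        qed
        have "\<eta> / 2 * (t + h - t) \<le> integral {t..t+h} g"
          using t0 elim h g by (intro integral_lower_bound continuous_on_subset[OF cont]) auto
        also have "\<dots> \<le> N (t + h) - N t"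
          using t0 elim h by (intro step) auto
        also have "\<dots> < h * \<eta> / 4"
          using NS[of "t + h"] mono[of t0 t] t0 elim h by auto
        finally show False using h eta by (simp add: algebra_simps)
      qed
    qed
  qed
qed

lemma integral_minus_const:
  fixes g :: "real \<Rightarrow> real"
  assumes "0 \<le> t" "continuous_on {0..} g"
  shows "integral {0..t} (\<lambda>r. g r - a) = integral {0..t} g - a * t"
proof -
  have "g integrable_on {0..t}"
    by (intro integrable_continuous_real continuous_on_subset[OF assms(2)]) auto
  from Henstock_Kurzweil_Integration.integral_diff[OF this integrable_const_ivl[of a]]
  show ?thesis
    using assms by (simp add: mult.commute)
qed

lemma sum_term_le:
  fixes h :: "'a \<Rightarrow> real"
  assumes "finite A" "k \<in> A" "sum h A \<le> K" "\<And>m. m \<in> A \<Longrightarrow> - b m \<le> h m"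
  shows "h k \<le> K + sum b (A - {k})"
proof -
  have "sum (\<lambda>m. - b m) (A - {k}) \<le> sum h (A - {k})"
    using assms by (intro sum_mono) auto
  then show ?thesis
    using assms(3) sum.remove[OF assms(1,2), of h] by (simp add: sum_negf)
qed

text \<open>\<open>M - mat 1\<close> is singular because it kills the constant vector, so its
  transpose kills some \<open>v \<noteq> 0\<close>. The absolute values of \<open>v\<close> satisfy
  an inequality in each coordinate, and both sides have the same total since the rows of
  \<open>M\<close> sum to 1; this forces equality, and positivity of \<open>M\<close> makes every
  entry positive.\<close>

lemma positive_stationary_vector:
  fixes M :: "real^'n^'n"
  assumes pos: "\<And>i j. 0 < M $ i $ j" and row: "\<And>i. (\<Sum>j\<in>UNIV. M $ i $ j) = 1"
  obtains x :: "'n \<Rightarrow> real" where "\<And>i. 0 < x i" "\<And>j. (\<Sum>i\<in>UNIV. x i * M $ i $ j) = x j"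
proof -
  define A where "A = M - mat 1"
  have "M *v (\<chi> i. 1) = (\<chi> i. 1)"
    by (simp add: vec_eq_iff matrix_vector_mult_def row)
  then have "A *v (\<chi> i. 1) = 0"
    by (simp add: A_def matrix_vector_mult_diff_rdistrib)
  moreover have "(\<chi> i. 1) \<noteq> (0 :: real^'n)"
    by (simp add: vec_eq_iff)
  ultimately have "\<not> invertible A"
    using matrix_left_invertible_ker[of A] invertible_left_inverse[of A] by blast
  then have "\<not> invertible (transpose A)"
    by (simp add: invertible_left_inverse[of A] invertible_right_inverse[of "transpose A"] right_invertible_transpose)
  then obtain v where v: "transpose A *v v = 0" "v \<noteq> 0"
    using matrix_left_invertible_ker[of "transpose A"] invertible_left_inverse by blast
  have "transpose A = transpose M - mat 1"
    by (auto simp: A_def transpose_def mat_def vec_eq_iff)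
  then have "transpose M *v v = v"
    using v(1) by (simp add: matrix_vector_mult_diff_rdistrib)
  then have v_eq: "(\<Sum>i\<in>UNIV. v $ i * M $ i $ j) = v $ j" for j
    by (simp add: vec_eq_iff matrix_vector_mult_def transpose_def mult.commute)
  have le: "\<bar>v $ j\<bar> \<le> (\<Sum>i\<in>UNIV. \<bar>v $ i\<bar> * M $ i $ j)" for j
  proof -
    have "\<bar>\<Sum>i\<in>UNIV. v $ i * M $ i $ j\<bar> \<le> (\<Sum>i\<in>UNIV. \<bar>v $ i * M $ i $ j\<bar>)" by (rule sum_abs)
    then show ?thesis using pos[THEN less_imp_le] by (simp add: v_eq abs_mult)
  qed
  have "(\<Sum>j\<in>UNIV. (\<Sum>i\<in>UNIV. \<bar>v $ i\<bar> * M $ i $ j) - \<bar>v $ j\<bar>) = 0"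
    unfolding sum_subtractf by (subst sum.swap) (simp add: row flip: sum_distrib_left)
  then have eq: "(\<Sum>i\<in>UNIV. \<bar>v $ i\<bar> * M $ i $ j) = \<bar>v $ j\<bar>" for j
    using le by (subst (asm) sum_nonneg_eq_0_iff) auto
  obtain k where k: "v $ k \<noteq> 0" using v(2) by (auto simp: vec_eq_iff)
  have "0 < \<bar>v $ j\<bar>" for j
  proof -
    have "0 < \<bar>v $ k\<bar> * M $ k $ j" using k pos by simp
    also have "\<dots> \<le> (\<Sum>i\<in>UNIV. \<bar>v $ i\<bar> * M $ i $ j)"
      using pos[THEN less_imp_le] by (intro member_le_sum[where f="\<lambda>i. \<bar>v $ i\<bar> * M $ i $ j"]) auto
    finally show ?thesis using eq by simp
  qed
  then show ?thesis using that[of "\<lambda>i. \<bar>v $ i\<bar>"] eq by blast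
qed

text \<open>The grid points \<open>?q n s\<close> lie strictly to the right of \<open>s\<close> and
  tend to \<open>s\<close>, so \<open>g\<close> is a pointwise limit of functions that factor
  through an integer-valued floor.\<close>

lemma right_continuous_borel_measurable:
  fixes g :: "real \<Rightarrow> real"
  assumes "\<And>t. (g \<longlongrightarrow> g t) (at_right t)"
  shows "g \<in> borel_measurable borel"
proof (rule borel_measurable_LIMSEQ_real)
  let ?q = "\<lambda>n s. (real_of_int \<lfloor>real (Suc n) * s\<rfloor> + 1) / real (Suc n)"
  fix s :: real
  have gt: "s < ?q n s" for n
  proof -
    have "real (Suc n) * s < real_of_int \<lfloor>real (Suc n) * s\<rfloor> + 1" by linarith
    then show ?thesis by (simp add: pos_less_divide_eq mult.commute del: of_nat_Suc)
  qed
  have le: "?q n s \<le> s + 1 / real (Suc n)" for n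
    by (simp add: field_simps del: of_nat_Suc)
  have "(\<lambda>n. s + 1 / real (Suc n)) \<longlonglongrightarrow> s + 0"
    by (intro tendsto_intros LIMSEQ_Suc[OF lim_1_over_n])
  then have lim: "(\<lambda>n. s + 1 / real (Suc n)) \<longlonglongrightarrow> s" by (simp only: add_0_right)
  have q_lim: "(\<lambda>n. ?q n s) \<longlonglongrightarrow> s"
    by (rule tendsto_sandwich[OF _ _ tendsto_const lim]; rule always_eventually; intro allI le less_imp_le[OF gt])
  have q_mem: "?q n s \<in> {s<..} \<and> ?q n s \<noteq> s" for n
    using gt[of n] by (intro conjI) (simp only: greaterThan_iff, rule less_imp_neq[symmetric])
  have "filterlim (\<lambda>n. ?q n s) (at_right s) sequentially"
    unfolding filterlim_at by (rule conjI[OF always_eventually[OF allI[OF q_mem]] q_lim])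
  from filterlim_compose[OF assms this]
  show "(\<lambda>n. g (?q n s)) \<longlonglongrightarrow> g s" .
next
  fix n
  have "(\<lambda>s. (\<lambda>k::int. g ((real_of_int k + 1) / real (Suc n))) \<lfloor>real (Suc n) * s\<rfloor>) \<in> borel_measurable borel"
    by (rule measurable_compose[where N="count_space UNIV"]) measurable
  then show "(\<lambda>s. g ((real_of_int \<lfloor>real (Suc n) * s\<rfloor> + 1) / real (Suc n))) \<in> borel_measurable borel"
    by simp
qed

lemma right_continuous_extension:
  fixes g :: "real \<Rightarrow> real"
  assumes "\<And>t. 0 \<le> t \<Longrightarrow> (g \<longlongrightarrow> g t) (at_right t)"
  shows "((\<lambda>s. g (max 0 s)) \<longlongrightarrow> g (max 0 t)) (at_right t)"
proof (cases "0 \<le> t")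
  case True
  have "eventually (\<lambda>s. g s = g (max 0 s)) (at_right t)"
    using True eventually_at_right_less[of t] by (auto elim!: eventually_mono)
  then have "((\<lambda>s. g (max 0 s)) \<longlongrightarrow> g t) (at_right t)"
    using assms[OF True] by (rule Lim_transform_eventually[rotated])
  then show ?thesis using True by simp
next
  case False
  then have "eventually (\<lambda>s. g 0 = g (max 0 s)) (at_right t)"
    by (auto simp: eventually_at_right_field max_def intro!: exI[of _ 0])
  then have "((\<lambda>s. g (max 0 s)) \<longlongrightarrow> g 0) (at_right t)"
    by (rule Lim_transform_eventually[OF tendsto_const])
  then show ?thesis using False by simp
qed

text \<open>Integrability has to be known before continuity, as paths are only cadlag at this stage.
  Values of \<open>g\<close> at negative times are arbitrary, hence the detour through
  \<open>max 0 s\<close>.\<close>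

lemma right_continuous_integrable:
  fixes g :: "real \<Rightarrow> real"
  assumes rc: "\<And>t. 0 \<le> t \<Longrightarrow> (g \<longlongrightarrow> g t) (at_right t)"
    and bdd: "\<And>t. 0 \<le> t \<Longrightarrow> \<bar>g t\<bar> \<le> B"
  shows "g integrable_on {0..t}"
proof -
  have "(\<lambda>s. g (max 0 s)) \<in> borel_measurable borel"
    by (intro right_continuous_borel_measurable right_continuous_extension rc)
  then have "(\<lambda>s. g (max 0 s)) \<in> borel_measurable (lebesgue_on {0..t})"
    by (intro measurable_restrict_space1 measurable_completion) simp
  then have "(\<lambda>s. g (max 0 s)) integrable_on {0..t}"
    by (rule measurable_bounded_by_integrable_imp_integrable[where g="\<lambda>_. B"]) (use bdd in auto)
  then show ?thesis
    by (rule integrable_eq) auto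
qed

lemma indefinite_integral_continuous_on_Ici:
  fixes g :: "real \<Rightarrow> real"
  assumes "\<And>t. g integrable_on {0..t}"
  shows "continuous_on {0..} (\<lambda>t. integral {0..t} g)"
  unfolding continuous_on_eq_continuous_within
proof
  fix t :: real assume t: "t \<in> {0..}"
  have "continuous (at t within {0..t+1}) (\<lambda>t. integral {0..t} g)"
    using indefinite_integral_continuous_1[OF assms[of "t + 1"]] t
    by (auto simp: continuous_on_eq_continuous_within)
  moreover have "at t within {0..t+1} = at t within {0..}"
    by (rule at_within_nhd[of _ "{..<t+1}"]) auto
  ultimately show "continuous (at t within {0..}) (\<lambda>t. integral {0..t} g)" by simp
qed

text \<open>By monotonicity a single \<open>s\<close> with \<open>v t - v s < d\<close> controls the
  whole interval between \<open>s\<close> and \<open>t\<close>.\<close>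

lemma continuous_on_Ici_left_right:
  fixes v :: "real \<Rightarrow> real"
  assumes mono: "mono_on {0..} v"
    and right: "\<And>t. 0 \<le> t \<Longrightarrow> (v \<longlongrightarrow> v t) (at_right t)"
    and left: "\<And>t d. 0 < t \<Longrightarrow> 0 < d \<Longrightarrow> \<exists>s\<ge>0. s < t \<and> v t - v s < d"
  shows "continuous_on {0..} v"
  unfolding continuous_on_def
proof
  fix t :: real assume "t \<in> {0..}"
  show "(v \<longlongrightarrow> v t) (at t within {0..})"
  proof (cases "t = 0")
    case True
    then show ?thesis using right[of 0] by (simp add: at_within_Ici_at_right)
  next
    case False
    then have t: "0 < t" using \<open>t \<in> {0..}\<close> by simp
    have "(v \<longlongrightarrow> v t) (at_left t)"
    proof (rule tendstoI)
      fix d :: real assume "0 < d"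
      then obtain s where s: "0 \<le> s" "s < t" "v t - v s < d" using left t by blast
      have "dist (v r) (v t) < d" if "s < r" "r < t" for r
        using mono_onD[OF mono, of s r] mono_onD[OF mono, of r t] s that by (auto simp: dist_real_def)
      then show "eventually (\<lambda>r. dist (v r) (v t) < d) (at_left t)"
        using s(2) by (auto simp: eventually_at_left_field)
    qed
    moreover have "at t within {0..} = at t"
      using t by (intro at_within_interior) auto
    ultimately show ?thesis using right[of t] t by (auto intro: filterlim_split_at)
  qed
qed

subsection \<open>Continuity of the regulator\<close>

text \<open>Turns the complementarity integral into pathwise facts. In use, \<open>v\<close> is a
  component of \<open>u\<close> and \<open>q\<close> the corresponding queue.\<close>

locale regulator =
  fixes v q :: "real \<Rightarrow> real"
  assumes v_mono: "mono_on {0..} v"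
    and v_right: "0 \<le> t \<Longrightarrow> (v \<longlongrightarrow> v t) (at_right t)"
    and q_right: "0 \<le> t \<Longrightarrow> (q \<longlongrightarrow> q t) (at_right t)"
    and q_nonneg: "0 \<le> t \<Longrightarrow> 0 \<le> q t"
    and compl: "(\<integral>\<^sup>+ s\<in>{0..}. ennreal (q s) \<partial>interval_measure (\<lambda>s. v (max 0 s))) = 0"
begin

abbreviation "\<nu> \<equiv> interval_measure (\<lambda>s. v (max 0 s))"

lemma measure_Ioc:
  assumes "0 \<le> s" "s \<le> t"
  shows "emeasure \<nu> {s<..t} = ennreal (v t - v s)"
proof -
  have "emeasure \<nu> {s<..t} = ennreal (v (max 0 t) - v (max 0 s))"
    using assms(2) mono_onD[OF v_mono] right_continuous_extension[of v] v_right
    by (intro emeasure_interval_measure_Ioc) (auto simp: continuous_within)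
  then show ?thesis using assms by simp
qed

lemma null_if_q_pos:
  assumes "A \<in> sets borel" "\<And>s. s \<in> A \<Longrightarrow> 0 \<le> s \<and> 0 < q s"
  shows "emeasure \<nu> A = 0"
proof -
  have "(\<lambda>s. q (max 0 s)) \<in> borel_measurable borel"
    by (intro right_continuous_borel_measurable right_continuous_extension q_right)
  then have "(\<lambda>s. ennreal (q (max 0 s)) * indicator {0..} s) \<in> borel_measurable \<nu>"
    by measurable
  moreover have "(\<lambda>s. ennreal (q (max 0 s)) * indicator {0..} s) = (\<lambda>s. ennreal (q s) * indicator {0..} s)"
    by (auto simp: indicator_def)
  ultimately have "AE s in \<nu>. ennreal (q s) * indicator {0..} s = 0"
    using compl by (subst (asm) nn_integral_0_iff_AE) auto
  then have "AE s in \<nu>. s \<notin> A"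
    by eventually_elim (use assms(2) in \<open>force simp: indicator_def\<close>)
  then show ?thesis
    using assms(1) by (subst (asm) AE_iff_measurable[of A]) auto
qed

text \<open>The measure of \<open>{s<..t}\<close> does not see \<open>s\<close>, so
  \<open>q s = 0\<close> is allowed. This lets a busy period start at the last zero of the
  queue.\<close>

lemma v_constant:
  assumes "0 \<le> s" "s \<le> t" "\<And>r. s < r \<Longrightarrow> r \<le> t \<Longrightarrow> 0 < q r"
  shows "v t = v s"
proof -
  have "ennreal (v t - v s) = 0"
    using measure_Ioc[OF assms(1,2)] null_if_q_pos[of "{s<..t}"] assms by auto
  then show ?thesis
    using mono_onD[OF v_mono, of s t] assms by (simp add: ennreal_eq_0_iff)
qed

text \<open>By continuity of the measure from above along \<open>A n\<close>, a jump of size at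
  least \<open>d\<close> would be an atom at \<open>t\<close> of mass at least \<open>d\<close>; but
  \<open>{t}\<close> is null because \<open>q t > 0\<close>.\<close>

lemma v_no_jump:
  assumes "0 < t" "0 < q t" "0 < d"
  shows "\<exists>s\<ge>0. s < t \<and> v t - v s < d"
proof (rule ccontr)
  assume "\<not> ?thesis"
  then have d: "d \<le> v t - v s" if "0 \<le> s" "s < t" for s
    using that by force
  \<comment> \<open>Already \<open>n = 0\<close> has left end 0, so all intervals stay where
    \<open>v\<close> is monotone.\<close>
  define A where "A n = {t - t / real (Suc n)<..t}" for n
  have bd: "0 \<le> t - t / real (Suc n)" "t - t / real (Suc n) < t" for n
    using assms(1) by (auto simp: field_simps)
  have A: "emeasure \<nu> (A n) = ennreal (v t - v (t - t / real (Suc n)))" for n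
    unfolding A_def using bd by (intro measure_Ioc) (auto intro: less_imp_le)
  have "A n \<subseteq> A m" if "m \<le> n" for m n
  proof -
    have "t / real (Suc n) \<le> t / real (Suc m)"
      using assms(1) that by (intro divide_left_mono) auto
    then show ?thesis unfolding A_def by (auto simp del: of_nat_Suc)
  qed
  then have "decseq A"
    by (auto simp: decseq_def)
  then have "(\<lambda>n. emeasure \<nu> (A n)) \<longlonglongrightarrow> emeasure \<nu> (\<Inter>n. A n)"
    by (intro Lim_emeasure_decseq) (simp_all add: A, simp add: A_def image_subset_iff)
  moreover have "(\<Inter>n. A n) = {t}"
  proof safe
    fix r assume "r \<in> (\<Inter>n. A n)"
    then have r: "t - t / real (Suc n) < r" "r \<le> t" for n by (auto simp: A_def)
    have "(\<lambda>n. t - t * (1 / real (Suc n))) \<longlonglongrightarrow> t - t * 0"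
      by (intro tendsto_intros LIMSEQ_Suc[OF lim_1_over_n])
    then have "t - t * 0 \<le> r"
      by (rule LIMSEQ_le_const2) (use r(1) in \<open>auto intro: less_imp_le\<close>)
    then show "r = t" using r by simp
  qed (use bd in \<open>auto simp: A_def\<close>)
  moreover have "emeasure \<nu> {t} = 0"
    using assms by (intro null_if_q_pos) auto
  moreover have "ennreal d \<le> emeasure \<nu> (A n)" for n
    unfolding A using bd[of n] by (intro ennreal_leI d)
  ultimately have "ennreal d \<le> 0"
    by (metis LIMSEQ_le_const)
  then show False using assms(3) by (simp add: ennreal_eq_0_iff)
qed

text \<open>
  At a jump of \<open>v\<close>, the queue \<open>q = h + l v\<close> would be positive, but \<open>v\<close> charges no point with
  \<open>q > 0\<close>.
\<close>

lemma v_continuous: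
  assumes l: "0 < l" and h: "continuous_on {0..} h" and q: "\<And>t. 0 \<le> t \<Longrightarrow> q t = h t + l * v t"
  shows "continuous_on {0..} v"
proof (rule continuous_on_Ici_left_right[OF v_mono v_right])
  fix t d :: real assume t: "0 < t" and d: "0 < d"
  show "\<exists>s\<ge>0. s < t \<and> v t - v s < d"
  proof (cases "0 < q t")
    case True
    then show ?thesis using v_no_jump t d by blast
  next
    case False
    then have q0: "q t = 0" using q_nonneg[of t] t by simp
    have "(h \<longlongrightarrow> h t) (at t within {0..})"
      using h t by (simp add: continuous_on_def)
    moreover have "at t within {0..} = at t"
      using t by (intro at_within_interior) auto
    ultimately have "(h \<longlongrightarrow> h t) (at_left t)"
      by (simp add: filterlim_at_split)
    then have "eventually (\<lambda>s. dist (h s) (h t) < l * d) (at_left t)"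
      using l d by (intro tendstoD) auto
    moreover have "eventually (\<lambda>s. s \<in> {0<..<t}) (at_left t)"
      using t by (rule eventually_at_left_real)
    ultimately have "eventually (\<lambda>s. dist (h s) (h t) < l * d \<and> s \<in> {0<..<t}) (at_left t)"
      by (rule eventually_conj)
    then obtain s where s: "dist (h s) (h t) < l * d" "s \<in> {0<..<t}"
      using eventually_happens trivial_limit_at_left_real by blast
    have "l * (v t - v s) < l * d"
      using q[of t] q[of s] q0 q_nonneg[of s] s t by (auto simp: dist_real_def algebra_simps)
    then show ?thesis using l s by (intro exI[of _ s]) auto
  qed
qed

end

subsection \<open>Flow balance\<close>

text \<open>Here \<open>u\<close> is hidden in \<open>X\<close>: monotonicity of \<open>u\<close>
  becomes \<open>X_le\<close>, complementarity becomes \<open>X_busy\<close>. That \<open>X\<close>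
  is itself nondecreasing is derived in \<open>X_mono\<close>.\<close>

locale fluid_flow =
  fixes lam :: "'r::finite \<Rightarrow> real"
    and mu P Q :: "'r \<Rightarrow> 'r \<Rightarrow> real"
    and e f :: "'r \<Rightarrow> 'r \<Rightarrow> real \<Rightarrow> real"
    and X :: "'r \<Rightarrow> real \<Rightarrow> real"
  assumes lam_pos: "0 < lam i"
    and mu_pos: "0 < mu i j"
    and P_pos: "0 < P i j"
    and Q_nonneg: "0 \<le> Q i j"
    and Q_diag: "0 < Q i i"
    and cont_e: "continuous_on {0..} (e i j)"
    and cont_f: "continuous_on {0..} (f i j)"
    and e_nonneg: "0 \<le> t \<Longrightarrow> 0 \<le> e i j t"
    and f_nonneg: "0 \<le> t \<Longrightarrow> 0 \<le> f i j t"
    and mass: "0 \<le> t \<Longrightarrow> (\<Sum>i\<in>UNIV. \<Sum>j\<in>UNIV. e i j t + f i j t) = 1"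
    and f_eq: "0 \<le> t \<Longrightarrow> f i j t = f i j 0 + P i j * X i t - mu i j * integral {0..t} (f i j)"
    and e_eq: "0 \<le> t \<Longrightarrow> i \<noteq> j \<Longrightarrow> e i j t = e i j 0 - mu i j * integral {0..t} (e i j)
          + Q i j * (\<Sum>k\<in>UNIV. mu k i * integral {0..t} (f k i))"
    and e_diag_eq: "0 \<le> t \<Longrightarrow> e i i t = e i i 0 - X i t
          + (\<Sum>k\<in>UNIV - {i}. mu k i * integral {0..t} (e k i))
          + Q i i * (\<Sum>k\<in>UNIV. mu k i * integral {0..t} (f k i))"
    and X_le: "0 \<le> s \<Longrightarrow> s \<le> t \<Longrightarrow> X i t - X i s \<le> lam i * (t - s)"
    and X_busy: "0 \<le> s \<Longrightarrow> s \<le> t \<Longrightarrow> (\<And>r. s < r \<Longrightarrow> r \<le> t \<Longrightarrow> 0 < e i i r)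
          \<Longrightarrow> X i t - X i s = lam i * (t - s)"
begin

section \<open>Increments of the flows over a window\<close>

lemma integral_e_diff: "0 \<le> s \<Longrightarrow> s \<le> t \<Longrightarrow>
    integral {0..t} (e i j) - integral {0..s} (e i j) = integral {s..t} (e i j)"
  using Henstock_Kurzweil_Integration.integral_combine[of 0 s t "e i j"]
    integrable_continuous_real[OF continuous_on_subset[OF cont_e, of "{0..t}" i j]] by auto

lemma integral_f_diff: "0 \<le> s \<Longrightarrow> s \<le> t \<Longrightarrow>
    integral {0..t} (f i j) - integral {0..s} (f i j) = integral {s..t} (f i j)"
  using Henstock_Kurzweil_Integration.integral_combine[of 0 s t "f i j"]
    integrable_continuous_real[OF continuous_on_subset[OF cont_f, of "{0..t}" i j]] by auto

text \<open>\<open>Y i\<close> is the cumulative flow out of loaded transit into station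
  \<open>i\<close>; \<open>J i\<close> below is the cumulative inflow into the queue
  \<open>e i i\<close>.\<close>

definition Y :: "'r \<Rightarrow> real \<Rightarrow> real" where
  "Y i t = (\<Sum>k\<in>UNIV. mu k i * integral {0..t} (f k i))"

definition J :: "'r \<Rightarrow> real \<Rightarrow> real" where
  "J i t = (\<Sum>k\<in>UNIV - {i}. mu k i * integral {0..t} (e k i)) + Q i i * Y i t"

lemma Y_diff:
  assumes "0 \<le> s" "s \<le> t"
  shows "Y i t - Y i s = (\<Sum>k\<in>UNIV. mu k i * integral {s..t} (f k i))"
  unfolding Y_def sum_subtractf[symmetric]
  using integral_f_diff[OF assms] by (simp add: right_diff_distrib[symmetric])

lemma J_diff:
  assumes "0 \<le> s" "s \<le> t"
  shows "J i t - J i s = (\<Sum>k\<in>UNIV - {i}. mu k i * integral {s..t} (e k i)) + Q i i * (Y i t - Y i s)"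
proof -
  have "(\<Sum>k\<in>UNIV - {i}. mu k i * integral {0..t} (e k i)) - (\<Sum>k\<in>UNIV - {i}. mu k i * integral {0..s} (e k i))
    = (\<Sum>k\<in>UNIV - {i}. mu k i * integral {s..t} (e k i))"
    unfolding sum_subtractf[symmetric]
    using integral_e_diff[OF assms] by (simp add: right_diff_distrib[symmetric])
  then show ?thesis
    unfolding J_def right_diff_distrib by linarith
qed

lemma f_diff: "0 \<le> s \<Longrightarrow> s \<le> t \<Longrightarrow>
    f i j t = f i j s + (P i j * X i t - P i j * X i s) - mu i j * integral {s..t} (f i j)"
  using f_eq[of s i j] f_eq[of t i j] integral_f_diff[of s t i j, symmetric]
  by (simp add: right_diff_distrib)

lemma e_diff: "0 \<le> s \<Longrightarrow> s \<le> t \<Longrightarrow> i \<noteq> j \<Longrightarrow>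
    e i j t = e i j s + (Q i j * Y i t - Q i j * Y i s) - mu i j * integral {s..t} (e i j)"
  using e_eq[of s i j] e_eq[of t i j] integral_e_diff[of s t i j, symmetric] unfolding Y_def[symmetric]
  by (simp add: right_diff_distrib)

lemma e_diag_diff: "0 \<le> s \<Longrightarrow> s \<le> t \<Longrightarrow>
    e i i t = e i i s + (J i t - J i s) - (X i t - X i s)"
  using e_diag_eq[of s i] e_diag_eq[of t i] unfolding J_def Y_def by simp

lemma Y_diff_ge:
  assumes "0 \<le> s" "s \<le> t" "\<And>k r. r \<in> {s..t} \<Longrightarrow> F k \<le> f k i r"
  shows "(\<Sum>k\<in>UNIV. mu k i * F k) * (t - s) \<le> Y i t - Y i s"
proof -
  have "F k * (t - s) \<le> integral {s..t} (f k i)" for k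
    using assms by (intro integral_lower_bound continuous_on_subset[OF cont_f]) auto
  then have "(\<Sum>k\<in>UNIV. mu k i * (F k * (t - s))) \<le> (\<Sum>k\<in>UNIV. mu k i * integral {s..t} (f k i))"
    using mu_pos by (intro sum_mono mult_left_mono) (auto simp: less_imp_le)
  also have "\<dots> = Y i t - Y i s"
    by (rule Y_diff[OF assms(1,2), symmetric])
  finally show ?thesis
    by (simp add: sum_distrib_right mult.assoc)
qed

lemma J_diff_ge:
  assumes "0 \<le> s" "s \<le> t" "\<And>k r. r \<in> {s..t} \<Longrightarrow> F k \<le> f k i r"
    "\<And>k r. r \<in> {s..t} \<Longrightarrow> k \<noteq> i \<Longrightarrow> E k \<le> e k i r"
  shows "((\<Sum>k\<in>UNIV - {i}. mu k i * E k) + Q i i * (\<Sum>k\<in>UNIV. mu k i * F k)) * (t - s)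
    \<le> J i t - J i s"
proof -
  have "E k * (t - s) \<le> integral {s..t} (e k i)" if "k \<noteq> i" for k
    using assms that by (intro integral_lower_bound continuous_on_subset[OF cont_e]) auto
  then have "(\<Sum>k\<in>UNIV-{i}. mu k i * (E k * (t - s))) \<le> (\<Sum>k\<in>UNIV-{i}. mu k i * integral {s..t} (e k i))"
    using mu_pos by (intro sum_mono mult_left_mono) (auto simp: less_imp_le)
  also have "\<dots> = J i t - J i s - Q i i * (Y i t - Y i s)"
    using J_diff[OF assms(1,2), of i] by simp
  finally have 1: "(\<Sum>k\<in>UNIV-{i}. mu k i * E k) * (t - s) \<le> J i t - J i s - Q i i * (Y i t - Y i s)"
    by (simp add: sum_distrib_right mult.assoc)
  have "Q i i * ((\<Sum>k\<in>UNIV. mu k i * F k) * (t - s)) \<le> Q i i * (Y i t - Y i s)"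
    using Q_nonneg assms by (intro mult_left_mono Y_diff_ge) auto
  with 1 show ?thesis
    unfolding distrib_right mult.assoc by linarith
qed

text \<open>Splits at the last zero \<open>\<tau>\<close> of the queue, which is attained since
  \<open>e i i\<close> is continuous; after \<open>\<tau>\<close> the station works at full
  rate.\<close>

lemma X_cases:
  assumes st: "0 \<le> s" "s \<le> t"
  obtains "X i t - X i s = lam i * (t - s)"
  | \<tau> where "\<tau> \<in> {s..t}" "e i i \<tau> = 0" "X i t - X i \<tau> = lam i * (t - \<tau>)"
proof (cases "\<forall>r. s < r \<and> r \<le> t \<longrightarrow> 0 < e i i r")
  case True
  then show ?thesis using X_busy st that(1) by blast
next
  case False
  define Z where "Z = {s..t} \<inter> e i i -` {0}"
  have "closed Z"
    unfolding Z_def using st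
    by (intro continuous_closed_preimage continuous_on_subset[OF cont_e]) auto
  moreover have "Z \<noteq> {}"
  proof -
    obtain r where r: "s < r" "r \<le> t" "\<not> 0 < e i i r" using False by blast
    then have "e i i r = 0" using e_nonneg[of r i i] st by auto
    then have "r \<in> Z" using r unfolding Z_def by simp
    then show ?thesis by blast
  qed
  moreover have bdd: "bdd_above Z" unfolding Z_def by auto
  ultimately have "Sup Z \<in> Z" by (intro closed_contains_Sup)
  then have S: "Sup Z \<in> {s..t}" "e i i (Sup Z) = 0" unfolding Z_def by auto
  have "0 < e i i r" if "Sup Z < r" "r \<le> t" for r
  proof (rule ccontr)
    assume "\<not> 0 < e i i r"
    then have "r \<in> Z" using e_nonneg[of r i i] S that st unfolding Z_def by auto
    then show False using cSup_upper[OF _ bdd] that by fastforce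
  qed
  then have "X i t - X i (Sup Z) = lam i * (t - Sup Z)"
    using S st by (intro X_busy) auto
  then show ?thesis using that(2) S by blast
qed

text \<open>At the last zero of the queue, the initial stock and all inflow since \<open>s\<close>
  have left, and from then on the rate \<open>lam i\<close> is at least \<open>k\<close>. Without a
  zero the station works at rate \<open>lam i\<close> throughout.\<close>

lemma X_diff_ge:
  assumes st: "0 \<le> s" "s \<le> t" and k: "k \<le> lam i"
    and J: "\<And>r. r \<in> {s..t} \<Longrightarrow> k * (r - s) \<le> J i r - J i s"
  shows "min (lam i * (t - s)) (e i i s + k * (t - s)) \<le> X i t - X i s"
proof (rule X_cases[OF st, where i=i])
  fix \<tau> assume \<tau>: "\<tau> \<in> {s..t}" "e i i \<tau> = 0" "X i t - X i \<tau> = lam i * (t - \<tau>)"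
  have "X i \<tau> - X i s = e i i s + (J i \<tau> - J i s)"
    using e_diag_diff[of s \<tau> i] \<tau> st by auto
  moreover have "k * (t - \<tau>) \<le> lam i * (t - \<tau>)"
    using k \<tau> by (intro mult_right_mono) auto
  ultimately have "e i i s + k * (t - s) \<le> X i t - X i s"
    using J[OF \<tau>(1)] \<tau> by (simp add: algebra_simps)
  then show ?thesis by simp
qed auto

lemma J_mono: "0 \<le> s \<Longrightarrow> s \<le> t \<Longrightarrow> J i s \<le> J i t"
  using J_diff_ge[of s t "\<lambda>_. 0" i "\<lambda>_. 0"] e_nonneg f_nonneg by simp

lemma X_mono:
  assumes "0 \<le> s" "s \<le> t"
  shows "X i s \<le> X i t"
proof -
  have "min (lam i * (t - s)) (e i i s + 0 * (t - s)) \<le> X i t - X i s"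
    using assms lam_pos[of i] J_mono[of s _ i] by (intro X_diff_ge) auto
  moreover have "0 \<le> lam i * (t - s)"
    using assms lam_pos[of i] by simp
  ultimately show ?thesis
    using e_nonneg[OF assms(1), of i i] by linarith
qed

section \<open>Bounds and Lipschitz estimates\<close>

lemma entry_le_1:
  assumes "0 \<le> t"
  shows "e i j t \<le> 1" "f i j t \<le> 1"
proof -
  have "e i j t + f i j t \<le> (\<Sum>j\<in>UNIV. e i j t + f i j t)"
    using e_nonneg f_nonneg assms by (intro member_le_sum) auto
  also have "\<dots> \<le> (\<Sum>i\<in>UNIV. \<Sum>j\<in>UNIV. e i j t + f i j t)"
    using e_nonneg f_nonneg assms by (intro member_le_sum[where f="\<lambda>i. \<Sum>j\<in>UNIV. e i j t + f i j t"] sum_nonneg) auto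
  finally show "e i j t \<le> 1" "f i j t \<le> 1"
    using mass assms e_nonneg[of t i j] f_nonneg[of t i j] by auto
qed

lemma integral_e_bounds:
  assumes "0 \<le> s" "s \<le> t"
  shows "0 \<le> integral {s..t} (e i j)" "integral {s..t} (e i j) \<le> t - s"
proof -
  have "continuous_on {s..t} (e i j)"
    using assms by (intro continuous_on_subset[OF cont_e]) auto
  from integral_lower_bound[OF assms(2) this, of 0]
    integral_lower_bound[OF assms(2) continuous_on_minus[OF this], of "-1"]
  show "0 \<le> integral {s..t} (e i j)" "integral {s..t} (e i j) \<le> t - s"
    using assms e_nonneg entry_le_1 by auto
qed

lemma integral_f_bounds:
  assumes "0 \<le> s" "s \<le> t"
  shows "0 \<le> integral {s..t} (f i j)" "integral {s..t} (f i j) \<le> t - s"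
proof -
  have "continuous_on {s..t} (f i j)"
    using assms by (intro continuous_on_subset[OF cont_f]) auto
  from integral_lower_bound[OF assms(2) this, of 0]
    integral_lower_bound[OF assms(2) continuous_on_minus[OF this], of "-1"]
  show "0 \<le> integral {s..t} (f i j)" "integral {s..t} (f i j) \<le> t - s"
    using assms f_nonneg entry_le_1 by auto
qed

lemma Y_diff_bounds:
  assumes "0 \<le> s" "s \<le> t"
  shows "0 \<le> Y i t - Y i s" "Y i t - Y i s \<le> (\<Sum>k\<in>UNIV. mu k i) * (t - s)"
proof -
  have "Y i t - Y i s = (\<Sum>k\<in>UNIV. mu k i * integral {s..t} (f k i))"
    by (rule Y_diff[OF assms(1,2)])
  moreover have "(\<Sum>k\<in>UNIV. mu k i * integral {s..t} (f k i)) \<le> (\<Sum>k\<in>UNIV. mu k i * (t - s))"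
    using mu_pos integral_f_bounds assms
    by (intro sum_mono mult_left_mono) (auto simp: less_imp_le)
  moreover have "0 \<le> (\<Sum>k\<in>UNIV. mu k i * integral {s..t} (f k i))"
    using mu_pos integral_f_bounds assms
    by (intro sum_nonneg mult_nonneg_nonneg) (auto simp: less_imp_le)
  ultimately show "0 \<le> Y i t - Y i s" "Y i t - Y i s \<le> (\<Sum>k\<in>UNIV. mu k i) * (t - s)"
    by (auto simp: sum_distrib_right)
qed

lemma f_lipschitz:
  assumes "0 \<le> s" "s \<le> t"
  shows "\<bar>f i j t - f i j s\<bar> \<le> (P i j * lam i + mu i j) * (t - s)"
proof -
  have "0 \<le> P i j * (X i t - X i s)" "P i j * (X i t - X i s) \<le> P i j * (lam i * (t - s))"
    using P_pos[of i j] X_mono[OF assms] X_le[OF assms] by (auto intro!: mult_left_mono mult_nonneg_nonneg)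
  moreover have "0 \<le> mu i j * integral {s..t} (f i j)" "mu i j * integral {s..t} (f i j) \<le> mu i j * (t - s)"
    using mu_pos[of i j] integral_f_bounds[OF assms] by (auto intro!: mult_left_mono mult_nonneg_nonneg)
  ultimately show ?thesis
    using f_diff[OF assms, of i j] by (simp add: algebra_simps)
qed

lemma e_lipschitz:
  assumes "0 \<le> s" "s \<le> t" "i \<noteq> j"
  shows "\<bar>e i j t - e i j s\<bar> \<le> (Q i j * (\<Sum>k\<in>UNIV. mu k i) + mu i j) * (t - s)"
proof -
  have "0 \<le> Q i j * (Y i t - Y i s)" "Q i j * (Y i t - Y i s) \<le> Q i j * ((\<Sum>k\<in>UNIV. mu k i) * (t - s))"
    using Q_nonneg[of i j] Y_diff_bounds[OF assms(1,2)] by (auto intro!: mult_left_mono mult_nonneg_nonneg)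
  moreover have "0 \<le> mu i j * integral {s..t} (e i j)" "mu i j * integral {s..t} (e i j) \<le> mu i j * (t - s)"
    using mu_pos[of i j] integral_e_bounds[OF assms(1,2)] by (auto intro!: mult_left_mono mult_nonneg_nonneg)
  ultimately show ?thesis
    using e_diff[OF assms] by (simp add: algebra_simps)
qed

lemma e_diag_ge:
  assumes "0 \<le> s" "s \<le> t"
  shows "e i i t \<ge> e i i s - lam i * (t - s)"
  using e_diag_diff[OF assms, of i] X_le[OF assms, of i] J_mono[OF assms, of i] by linarith

end

subsection \<open>Levels below equilibrium\<close>

locale fluid_equilibrium = fluid_flow lam mu P Q e f X
  for lam :: "'r::finite \<Rightarrow> real" and mu P Q e f X +
  fixes x :: "'r \<Rightarrow> real"
  assumes x_pos: "0 < x i"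
    and x_inv: "x i = (\<Sum>k\<in>UNIV. (\<Sum>l\<in>UNIV. x l * P l k) * Q k i)"
    and x_le: "x i \<le> lam i"
    and x_tight: "\<exists>i. x i = lam i"
begin

definition y :: "'r \<Rightarrow> real" where
  "y i = (\<Sum>k\<in>UNIV. x k * P k i)"

definition fs :: "'r \<Rightarrow> 'r \<Rightarrow> real" where
  "fs i j = x i * P i j / mu i j"

text \<open>The diagonal is set to 0 so that \<open>below\<close> puts no constraint on the queues \<open>e i i\<close>.\<close>

definition es :: "'r \<Rightarrow> 'r \<Rightarrow> real" where
  "es i j = (if i = j then 0 else Q i j * y i / mu i j)"

definition below :: "real \<Rightarrow> real \<Rightarrow> bool" where
  "below k t \<longleftrightarrow> (\<forall>i j. k * fs i j \<le> f i j t \<and> k * es i j \<le> e i j t)"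

lemma y_pos: "0 < y i"
  unfolding y_def using x_pos P_pos by (intro sum_pos) auto

lemma fs_pos: "0 < fs i j"
  unfolding fs_def using x_pos P_pos mu_pos by simp

lemma es_nonneg: "0 \<le> es i j"
  unfolding es_def using y_pos[of i] Q_nonneg mu_pos[of i j] by simp

lemma mu_fs: "mu i j * fs i j = x i * P i j"
  using mu_pos[of i j] by (simp add: fs_def)

lemma mu_es: "i \<noteq> j \<Longrightarrow> mu i j * es i j = Q i j * y i"
  using mu_pos[of i j] by (simp add: es_def)

lemma sum_mu_fs: "(\<Sum>k\<in>UNIV. mu k i * fs k i) = y i"
  by (simp add: mu_fs y_def)

lemma x_balance: "(\<Sum>k\<in>UNIV - {i}. mu k i * es k i) + Q i i * y i = x i"
proof -
  have "(\<Sum>k\<in>UNIV - {i}. mu k i * es k i) = (\<Sum>k\<in>UNIV - {i}. y k * Q k i)"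
    by (intro sum.cong) (auto simp: mu_es)
  moreover have "x i = y i * Q i i + (\<Sum>k\<in>UNIV - {i}. y k * Q k i)"
    using x_inv[of i] sum.remove[of UNIV i "\<lambda>k. y k * Q k i"] by (simp add: y_def)
  ultimately show ?thesis by simp
qed

section \<open>Flows sustained by a level, and its persistence\<close>

lemma below_mono: "below k t \<Longrightarrow> k' \<le> k \<Longrightarrow> below k' t"
  unfolding below_def using fs_pos es_nonneg
  by (meson less_imp_le mult_right_mono order_trans)

lemma Y_diff_ge_below:
  assumes st: "0 \<le> s" "s \<le> t" and b: "\<And>r. r \<in> {s..t} \<Longrightarrow> below k r"
  shows "k * y i * (t - s) \<le> Y i t - Y i s"
proof -
  have "(\<Sum>l\<in>UNIV. mu l i * (k * fs l i)) * (t - s) \<le> Y i t - Y i s"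
    using b by (intro Y_diff_ge st) (auto simp: below_def)
  also have "(\<Sum>l\<in>UNIV. mu l i * (k * fs l i)) = k * y i"
    by (simp add: sum_mu_fs[symmetric] sum_distrib_left mult_ac)
  finally show ?thesis .
qed

text \<open>The level alone feeds the queue at rate \<open>k * x i\<close> by
  \<open>x_balance\<close>. A surplus \<open>a\<close> on the loaded edge from \<open>l\<close>
  joins with the share \<open>Q i i\<close>, a surplus \<open>a'\<close> on the empty edge in full;
  for \<open>l = i\<close> there is no such edge, as \<open>e i i\<close> is the queue
  itself.\<close>

lemma J_diff_ge_surplus:
  assumes st: "0 \<le> s" "s \<le> t" and b: "\<And>r. r \<in> {s..t} \<Longrightarrow> below k r"
    and a: "\<And>r. r \<in> {s..t} \<Longrightarrow> k * fs l i + a \<le> f l i r"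
    and a': "\<And>r. r \<in> {s..t} \<Longrightarrow> l \<noteq> i \<Longrightarrow> k * es l i + a' \<le> e l i r"
  shows "(k * x i + Q i i * mu l i * a + (if l = i then 0 else mu l i * a')) * (t - s) \<le> J i t - J i s"
proof -
  let ?F = "\<lambda>m. k * fs m i + (if m = l then a else 0)"
  let ?E = "\<lambda>m. k * es m i + (if m = l then a' else 0)"
  have "((\<Sum>m\<in>UNIV - {i}. mu m i * ?E m) + Q i i * (\<Sum>m\<in>UNIV. mu m i * ?F m)) * (t - s)
    \<le> J i t - J i s"
    using b a a' by (intro J_diff_ge st) (auto simp: below_def)
  moreover have "(\<Sum>m\<in>UNIV. mu m i * ?F m) = k * y i + mu l i * a"
  proof -
    have "(\<Sum>m\<in>UNIV. mu m i * ?F m) = (\<Sum>m\<in>UNIV. k * (mu m i * fs m i) + (if m = l then mu m i * a else 0))"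
      by (intro sum.cong) (auto simp: algebra_simps)
    then show ?thesis
      by (simp add: sum.distrib sum_distrib_left[symmetric] sum_mu_fs)
  qed
  moreover have "(\<Sum>m\<in>UNIV - {i}. mu m i * ?E m)
    = k * (\<Sum>m\<in>UNIV - {i}. mu m i * es m i) + (if l = i then 0 else mu l i * a')"
  proof -
    have "(\<Sum>m\<in>UNIV - {i}. mu m i * ?E m)
      = (\<Sum>m\<in>UNIV - {i}. k * (mu m i * es m i) + (if m = l then mu m i * a' else 0))"
      by (intro sum.cong) (auto simp: algebra_simps)
    then show ?thesis
      by (simp add: sum.distrib sum_distrib_left[symmetric])
  qed
  moreover have "k * (\<Sum>m\<in>UNIV - {i}. mu m i * es m i) + (if l = i then 0 else mu l i * a')
    + Q i i * (k * y i + mu l i * a)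
    = k * x i + Q i i * mu l i * a + (if l = i then 0 else mu l i * a')"
    unfolding x_balance[of i, symmetric] by (simp add: algebra_simps)
  ultimately show ?thesis by simp
qed

lemma J_diff_ge_below:
  assumes "0 \<le> s" "s \<le> t" "\<And>r. r \<in> {s..t} \<Longrightarrow> below k r"
  shows "k * x i * (t - s) \<le> J i t - J i s"
  using J_diff_ge_surplus[OF assms, of i i 0 0] assms by (auto simp: below_def)

lemma kx_le_lam: "k \<le> 1 \<Longrightarrow> k * x i \<le> lam i"
  using mult_right_mono[of k 1 "x i"] x_pos[of i] x_le[of i] by linarith

lemma X_diff_ge_below:
  assumes "0 \<le> s" "s \<le> t" "\<And>r. r \<in> {s..t} \<Longrightarrow> below k r" and k: "k \<le> 1"
  shows "k * x i * (t - s) \<le> X i t - X i s"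
proof -
  have "min (lam i * (t - s)) (e i i s + k * x i * (t - s)) \<le> X i t - X i s"
    using assms by (intro X_diff_ge J_diff_ge_below kx_le_lam) auto
  moreover have "k * x i * (t - s) \<le> lam i * (t - s)"
    using assms by (intro mult_right_mono kx_le_lam) auto
  ultimately show ?thesis
    using e_nonneg[OF assms(1), of i i] by linarith
qed

text \<open>Departures at rate \<open>k * x i\<close> sustain exactly the load
  \<open>k * fs i j\<close> by \<open>mu_fs\<close>; whatever departs beyond this is the surplus in
  \<open>relax_lower_bound\<close>.\<close>

lemma f_relax:
  assumes st: "0 \<le> s" "s \<le> t" "\<And>r. r \<in> {s..t} \<Longrightarrow> below k r" and k: "k \<le> 1"
  shows "exp (- mu i j * (t - s)) * (f i j s - k * fs i j + P i j * (X i t - X i s - k * x i * (t - s)))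
    \<le> f i j t - k * fs i j"
proof -
  have "exp (- mu i j * (t - s)) * (f i j s - k * fs i j + (P i j * X i t - P i j * X i s - mu i j * (k * fs i j) * (t - s)))
    \<le> f i j t - k * fs i j"
  proof (rule relax_lower_bound[OF mu_pos st(2)])
    show "continuous_on {s..t} (f i j)"
      using st by (intro continuous_on_subset[OF cont_f]) auto
    show "f i j r = f i j s + (P i j * X i r - P i j * X i s) - mu i j * integral {s..r} (f i j)"
      if "r \<in> {s..t}" for r
      using that st by (intro f_diff) auto
    show "mu i j * (k * fs i j) * (t - r) \<le> P i j * X i t - P i j * X i r" if "r \<in> {s..t}" for r
    proof -
      have "P i j * (k * x i * (t - r)) \<le> P i j * (X i t - X i r)"
        using that st k P_pos[of i j] by (intro mult_left_mono X_diff_ge_below) auto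
      moreover have "mu i j * (k * fs i j) * (t - r) = P i j * (k * x i * (t - r))"
        using mu_fs[of i j] by (simp add: mult_ac)
      ultimately show ?thesis by (simp add: right_diff_distrib)
    qed
  qed
  moreover have "mu i j * (k * fs i j) * (t - s) = P i j * (k * x i * (t - s))"
    using mu_fs[of i j] by (simp add: mult_ac)
  ultimately show ?thesis
    by (simp add: right_diff_distrib)
qed

lemma e_relax:
  assumes st: "0 \<le> s" "s \<le> t" "\<And>r. r \<in> {s..t} \<Longrightarrow> below k r" and ij: "i \<noteq> j"
  shows "exp (- mu i j * (t - s)) * (e i j s - k * es i j + Q i j * (Y i t - Y i s - k * y i * (t - s)))
    \<le> e i j t - k * es i j"
proof -
  have "exp (- mu i j * (t - s)) * (e i j s - k * es i j + (Q i j * Y i t - Q i j * Y i s - mu i j * (k * es i j) * (t - s)))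
    \<le> e i j t - k * es i j"
  proof (rule relax_lower_bound[OF mu_pos st(2)])
    show "continuous_on {s..t} (e i j)"
      using st by (intro continuous_on_subset[OF cont_e]) auto
    show "e i j r = e i j s + (Q i j * Y i r - Q i j * Y i s) - mu i j * integral {s..r} (e i j)"
      if "r \<in> {s..t}" for r
      using that st ij by (intro e_diff) auto
    show "mu i j * (k * es i j) * (t - r) \<le> Q i j * Y i t - Q i j * Y i r" if "r \<in> {s..t}" for r
    proof -
      have "Q i j * (k * y i * (t - r)) \<le> Q i j * (Y i t - Y i r)"
        using that st Q_nonneg[of i j] by (intro mult_left_mono Y_diff_ge_below) auto
      moreover have "mu i j * (k * es i j) * (t - r) = Q i j * (k * y i * (t - r))"
        using mu_es[OF ij] by (simp add: mult_ac)
      ultimately show ?thesis by (simp add: right_diff_distrib)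
    qed
  qed
  moreover have "mu i j * (k * es i j) * (t - s) = Q i j * (k * y i * (t - s))"
    using mu_es[OF ij] by (simp add: mult_ac)
  ultimately show ?thesis
    by (simp add: right_diff_distrib)
qed

text \<open>The level \<open>k'\<close> on the whole window is used only for the inflows. The extra
  \<open>k - k'\<close> is known at \<open>s\<close> alone, and at least the fraction
  \<open>w\<close> of it survives until any \<open>r\<close> in the window.\<close>

lemma below_improve:
  assumes st: "0 \<le> s" "\<And>r. r \<in> {s..t} \<Longrightarrow> below k' r" and b: "below k s" and k: "k' \<le> k" "k \<le> 1"
    and w: "\<And>i j. w \<le> exp (- mu i j * (t - s))" "0 \<le> w" and r: "r \<in> {s..t}"
  shows "below (k' + w * (k - k')) r"
proof -
  have b': "\<And>q. q \<in> {s..r} \<Longrightarrow> below k' q"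
    using st r by auto
  have w': "w \<le> exp (- mu i j * (r - s))" for i j
  proof -
    have "mu i j * (r - s) \<le> mu i j * (t - s)"
      using r mu_pos[of i j] by (intro mult_left_mono) auto
    then show ?thesis
      using w(1)[of i j] by (intro order.trans[OF w(1)]) simp
  qed
  have "w * ((k - k') * fs i j) \<le> f i j r - k' * fs i j" for i j
  proof -
    have "0 \<le> P i j * (X i r - X i s - k' * x i * (r - s))"
      using X_diff_ge_below[of s r k' i] st(1) b' r k P_pos[of i j] by (intro mult_nonneg_nonneg) auto
    moreover have "k * fs i j \<le> f i j s" using b by (simp add: below_def)
    ultimately have "(k - k') * fs i j \<le> f i j s - k' * fs i j + P i j * (X i r - X i s - k' * x i * (r - s))"
      unfolding left_diff_distrib by linarith
    moreover have "0 \<le> (k - k') * fs i j" using k fs_pos[of i j] by simp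
    ultimately have "w * ((k - k') * fs i j) \<le> exp (- mu i j * (r - s)) *
       (f i j s - k' * fs i j + P i j * (X i r - X i s - k' * x i * (r - s)))"
      using w' by (intro mult_mono) auto
    also have "\<dots> \<le> f i j r - k' * fs i j"
      using st b' r k by (intro f_relax) auto
    finally show ?thesis .
  qed
  moreover have "w * ((k - k') * es i j) \<le> e i j r - k' * es i j" for i j
  proof (cases "i = j")
    case True
    then show ?thesis using e_nonneg[of r i j] st r by (simp add: es_def)
  next
    case False
    have "0 \<le> Q i j * (Y i r - Y i s - k' * y i * (r - s))"
      using Y_diff_ge_below[of s r k' i] st(1) b' r Q_nonneg[of i j] by (intro mult_nonneg_nonneg) auto
    moreover have "k * es i j \<le> e i j s" using b by (simp add: below_def)
    ultimately have "(k - k') * es i j \<le> e i j s - k' * es i j + Q i j * (Y i r - Y i s - k' * y i * (r - s))"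
      unfolding left_diff_distrib by linarith
    moreover have "0 \<le> (k - k') * es i j" using k es_nonneg[of i j] by simp
    ultimately have "w * ((k - k') * es i j) \<le> exp (- mu i j * (r - s)) *
       (e i j s - k' * es i j + Q i j * (Y i r - Y i s - k' * y i * (r - s)))"
      using w' by (intro mult_mono) auto
    also have "\<dots> \<le> e i j r - k' * es i j"
      using st b' r k False by (intro e_relax) auto
    finally show ?thesis .
  qed
  ultimately show ?thesis
    unfolding below_def by (simp add: distrib_right mult.assoc le_diff_eq add.commute)
qed

text \<open>
  On a window \<open>[s, t]\<close> the level \<open>0\<close> is always respected; each application of
  \<open>below_improve\<close> moves the level a fixed fraction \<open>w\<close> of the way up to \<open>k\<close>.
\<close>

lemma below_invariant:
  assumes s: "0 \<le> s" "s \<le> t" and b: "below k s" and k: "0 \<le> k" "k \<le> 1"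
  shows "below k t"
proof -
  \<comment> \<open>The sum of all rates dominates each of them, so \<open>w\<close> is a survival
    fraction for every compartment. Only \<open>w > 0\<close> matters, so the window may have any
    length.\<close>
  define M where "M = (\<Sum>i\<in>UNIV. \<Sum>j\<in>UNIV. mu i j)"
  define w where "w = exp (- M * (t - s))"
  have M: "mu i j \<le> M" for i j
  proof -
    have "mu i j \<le> (\<Sum>j\<in>UNIV. mu i j)"
      using mu_pos by (intro member_le_sum) (auto simp: less_imp_le)
    also have "\<dots> \<le> M"
      unfolding M_def using mu_pos
      by (intro member_le_sum[where f="\<lambda>i. \<Sum>j\<in>UNIV. mu i j"] sum_nonneg) (auto simp: less_imp_le)
    finally show ?thesis .
  qed
  then have "0 \<le> M" using mu_pos less_imp_le order_trans by blast
  then have w: "0 < w" "w \<le> 1" using s by (auto simp: w_def)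
  have wmu: "w \<le> exp (- mu i j * (t - s))" for i j
    using M[of i j] s by (auto simp: w_def intro: mult_right_mono)
  have "\<forall>r\<in>{s..t}. below (k - k * (1 - w) ^ n) r" for n
  proof (induction n)
    case 0
    then show ?case using e_nonneg f_nonneg s by (auto simp: below_def)
  next
    case (Suc n)
    let ?k = "k - k * (1 - w) ^ n"
    have "below (?k + w * (k - ?k)) r" if "r \<in> {s..t}" for r
      using s Suc b k w wmu that by (intro below_improve[of s t]) auto
    moreover have "?k + w * (k - ?k) = k - k * (1 - w) ^ Suc n"
      by (simp add: algebra_simps)
    ultimately show ?case by metis
  qed
  then have bn: "below (k - k * (1 - w) ^ n) t" for n
    using s by auto
  have lim: "(\<lambda>n. (k - k * (1 - w) ^ n) * c) \<longlonglongrightarrow> (k - k * 0) * c" for c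
    using w by (intro tendsto_intros LIMSEQ_power_zero) auto
  show ?thesis
    unfolding below_def
  proof (intro allI conjI)
    fix i j
    show "k * fs i j \<le> f i j t" "k * es i j \<le> e i j t"
      using LIMSEQ_le_const2[OF lim, of "fs i j"] LIMSEQ_le_const2[OF lim, of "es i j"] bn
      unfolding below_def by auto
  qed
qed

subsection \<open>Exponential improvement of the level\<close>

text \<open>One constant below every rate, share and unit-time survival factor, so that all losses
  become powers of \<open>g\<close>. Off the diagonal \<open>Q i j\<close> may be 0, which is why it
  is compared with \<open>es i j\<close> instead of being bounded below. The last two conditions
  convert a surplus of mass into a gain of level.\<close>

definition rate_bound :: "real \<Rightarrow> bool" where
  "rate_bound g \<longleftrightarrow> 0 < g \<and> g < 1 \<and> (\<forall>i j. g \<le> exp (- mu i j) \<and> g \<le> mu i j \<and> g \<le> P i j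
     \<and> g \<le> Q i i \<and> g \<le> x i \<and> g * fs i j \<le> 1 \<and> g * es i j \<le> Q i j)"

lemma rate_bound_exists: "\<exists>g. rate_bound g"
proof -
  \<comment> \<open>\<open>1/2\<close> keeps \<open>g\<close> below 1; \<open>mu i j / y i\<close>
    serves the bound on \<open>es i j\<close>, which is \<open>Q i j * y i / mu i j\<close> off the
    diagonal.\<close>
  define A where "A = insert (1/2) (\<Union>i. \<Union>j. {exp (- mu i j), mu i j, P i j, Q i i, x i, 1 / fs i j, mu i j / y i})"
  have A: "finite A" "A \<noteq> {}" unfolding A_def by auto
  have le: "Min A \<le> a" if "a \<in> A" for a using A that by simp
  have "a > 0" if "a \<in> A" for a
    using that mu_pos P_pos Q_diag x_pos fs_pos y_pos unfolding A_def by auto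
  then have pos: "0 < Min A" using A by simp
  have "Min A * es i j \<le> Q i j" for i j
  proof -
    have "Min A \<le> mu i j / y i" unfolding A_def by (intro le[unfolded A_def]) blast
    then have "Min A * (Q i j * y i / mu i j) \<le> mu i j / y i * (Q i j * y i / mu i j)"
      using Q_nonneg[of i j] y_pos[of i] mu_pos[of i j] by (intro mult_right_mono) auto
    also have "\<dots> = Q i j" using y_pos[of i] mu_pos[of i j] by simp
    finally show ?thesis using Q_nonneg[of i j] Q_nonneg[of j j] by (simp add: es_def)
  qed
  moreover have "Min A * fs i j \<le> 1" for i j
  proof -
    have "Min A \<le> 1 / fs i j" unfolding A_def by (intro le[unfolded A_def]) blast
    then show ?thesis using fs_pos[of i j] by (simp add: pos_le_divide_eq)
  qed
  moreover have "Min A \<le> exp (- mu i j)" "Min A \<le> mu i j" "Min A \<le> P i j" "Min A \<le> Q i i" "Min A \<le> x i" "Min A \<le> 1/2" for i j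
    unfolding A_def by (intro le[unfolded A_def]; blast)+
  ultimately have "rate_bound (Min A)"
    unfolding rate_bound_def using pos by (smt (verit) field_sum_of_halves)
  then show ?thesis ..
qed

section \<open>Spread of a surplus over unit time windows\<close>

context
  fixes g assumes g: "rate_bound g"
begin

lemma g_bounds: "0 < g" "g < 1" "g \<le> exp (- mu i j)" "g \<le> mu i j" "g \<le> P i j"
    "g \<le> Q i i" "g \<le> x i" "g * fs i j \<le> 1" "g * es i j \<le> Q i j"
  using g unfolding rate_bound_def by auto

lemma g_le_exp: "r \<in> {s..s + 1} \<Longrightarrow> g \<le> exp (- mu i j * (r - s))"
  using mult_left_mono[of "r - s" 1 "mu i j"] mu_pos[of i j]
  by (intro order_trans[OF g_bounds(3)[of i j]]) simp

lemma f_surplus: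
  assumes s: "0 \<le> s" "r \<in> {s..s + 1}" and b: "below k s" and k: "0 \<le> k" "k \<le> 1"
    and a: "0 \<le> a" "a \<le> f i j s - k * fs i j + P i j * (X i r - X i s - k * x i * (r - s))"
  shows "k * fs i j + g * a \<le> f i j r"
proof -
  have "g * a \<le> exp (- mu i j * (r - s)) * (f i j s - k * fs i j + P i j * (X i r - X i s - k * x i * (r - s)))"
    using g_le_exp[OF s(2)] a by (intro mult_mono) auto
  also have "\<dots> \<le> f i j r - k * fs i j"
    using s b k below_invariant[OF s(1) _ b] by (intro f_relax) auto
  finally show ?thesis by simp
qed

lemma e_surplus:
  assumes s: "0 \<le> s" "r \<in> {s..s + 1}" and b: "below k s" and k: "0 \<le> k" "k \<le> 1" and ij: "i \<noteq> j"
    and a: "0 \<le> a" "a \<le> e i j s - k * es i j + Q i j * (Y i r - Y i s - k * y i * (r - s))"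
  shows "k * es i j + g * a \<le> e i j r"
proof -
  have "g * a \<le> exp (- mu i j * (r - s)) * (e i j s - k * es i j + Q i j * (Y i r - Y i s - k * y i * (r - s)))"
    using g_le_exp[OF s(2)] a by (intro mult_mono) auto
  also have "\<dots> \<le> e i j r - k * es i j"
    using s b k ij below_invariant[OF s(1) _ b] by (intro e_relax) auto
  finally show ?thesis by simp
qed

lemma f_surplus_persists:
  assumes s: "0 \<le> s" "r \<in> {s..s + 1}" and b: "below k s" and k: "0 \<le> k" "k \<le> 1"
    and a: "0 \<le> a" "k * fs i j + a \<le> f i j s"
  shows "k * fs i j + g * a \<le> f i j r"
proof (rule f_surplus[OF s b k a(1)])
  have "0 \<le> P i j * (X i r - X i s - k * x i * (r - s))"
    using X_diff_ge_below[of s r k i] below_invariant[OF s(1) _ b] s k P_pos[of i j]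
    by (intro mult_nonneg_nonneg) auto
  then show "a \<le> f i j s - k * fs i j + P i j * (X i r - X i s - k * x i * (r - s))"
    using a by linarith
qed

lemma e_surplus_persists:
  assumes s: "0 \<le> s" "r \<in> {s..s + 1}" and b: "below k s" and k: "0 \<le> k" "k \<le> 1" and ij: "i \<noteq> j"
    and a: "0 \<le> a" "k * es i j + a \<le> e i j s"
  shows "k * es i j + g * a \<le> e i j r"
proof (rule e_surplus[OF s b k ij a(1)])
  have "0 \<le> Q i j * (Y i r - Y i s - k * y i * (r - s))"
    using Y_diff_ge_below[of s r k i] below_invariant[OF s(1) _ b] s k Q_nonneg[of i j]
    by (intro mult_nonneg_nonneg) auto
  then show "a \<le> e i j s - k * es i j + Q i j * (Y i r - Y i s - k * y i * (r - s))"
    using a by linarith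
qed

text \<open>\<open>X_diff_ge\<close> needs a target rate of at most \<open>lam i\<close>. At a
  bottleneck the spare capacity is only proportional to the missing level, hence the cap
  \<open>g * d\<close> on all gains below.\<close>

lemma level_le_lam:
  assumes "0 \<le> d" "k + d \<le> 1"
  shows "k * x i + g * d \<le> lam i"
proof -
  have "g * d \<le> x i * d" using assms g_bounds(7) by (intro mult_right_mono) auto
  then have "k * x i + g * d \<le> (k + d) * x i" by (simp add: algebra_simps)
  also have "\<dots> \<le> lam i" using assms kx_le_lam by simp
  finally show ?thesis .
qed

text \<open>The three factors \<open>g\<close> stand for survival of the surplus, its arrival rate
  \<open>mu l i\<close> and the share \<open>Q i i\<close> that joins the queue. Empty transit loses
  no share, but the same power covers it.\<close>

lemma X_gain_flow:
  assumes s: "0 \<le> s" and b: "below k s" and k: "0 \<le> k" "0 \<le> d" "k + d \<le> 1" and a: "0 \<le> a"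
    and sur: "k * fs l i + a \<le> f l i s \<or> l \<noteq> i \<and> k * es l i + a \<le> e l i s"
  shows "k * x i + min (g * d) (g ^ 3 * a) \<le> X i (s + 1) - X i s"
proof -
  let ?k = "k * x i + min (g * d) (g ^ 3 * a)"
  have b': "below k r" if "s \<le> r" for r
    using below_invariant[OF s that b] k by simp
  have J: "?k * (r - s) \<le> J i r - J i s" if r: "r \<in> {s..s + 1}" for r
  proof -
    have "(k * x i + g ^ 3 * a) * (r - s) \<le> J i r - J i s"
      using sur
    proof
      assume sur: "k * fs l i + a \<le> f l i s"
      have J: "(k * x i + Q i i * mu l i * (g * a) + (if l = i then 0 else mu l i * 0)) * (r - s) \<le> J i r - J i s"
        using s r k b' f_surplus_persists[OF s _ b _ _ a sur]
        by (intro J_diff_ge_surplus) (auto simp: below_def)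
      have "g * g * (g * a) \<le> Q i i * mu l i * (g * a)"
        using g_bounds(1,2) g_bounds(6)[of i] g_bounds(4)[of l i] Q_nonneg[of i i] a by (intro mult_right_mono mult_mono) auto
      then have "(k * x i + g ^ 3 * a) * (r - s) \<le> (k * x i + Q i i * mu l i * (g * a)) * (r - s)"
        using r by (intro mult_right_mono) (auto simp: power3_eq_cube mult.assoc)
      also have "\<dots> \<le> J i r - J i s" using J by (simp only: mult_zero_right if_cancel add_0_right)
      finally show ?thesis .
    next
      assume sur: "l \<noteq> i \<and> k * es l i + a \<le> e l i s"
      have J: "(k * x i + Q i i * mu l i * 0 + (if l = i then 0 else mu l i * (g * a))) * (r - s) \<le> J i r - J i s"
        using s r k b' e_surplus_persists[OF s _ b _ _ _ a] sur
        by (intro J_diff_ge_surplus) (auto simp: below_def)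
      have "g * g * (g * a) \<le> 1 * mu l i * (g * a)"
        using g_bounds(1,2) g_bounds(6)[of i] g_bounds(4)[of l i] Q_nonneg[of i i] a by (intro mult_right_mono mult_mono) auto
      then have "(k * x i + g ^ 3 * a) * (r - s) \<le> (k * x i + mu l i * (g * a)) * (r - s)"
        using r by (intro mult_right_mono) (auto simp: power3_eq_cube mult.assoc)
      also have "\<dots> \<le> J i r - J i s" using J sur by (simp only: mult_zero_right if_False add_0_right)
      finally show ?thesis .
    qed
    moreover have "?k * (r - s) \<le> (k * x i + g ^ 3 * a) * (r - s)"
      using r by (intro mult_right_mono) auto
    ultimately show ?thesis by linarith
  qed
  have "?k \<le> lam i" using level_le_lam[OF k(2,3), of i] by linarith
  then have "min (lam i * (s + 1 - s)) (e i i s + ?k * (s + 1 - s)) \<le> X i (s + 1) - X i s"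
    using s J by (intro X_diff_ge) auto
  then show ?thesis using \<open>?k \<le> lam i\<close> e_nonneg[OF s, of i i] by simp
qed

text \<open>Stock already in the queue leaves within one unit of time unless capacity binds.\<close>

lemma X_gain_queue:
  assumes s: "0 \<le> s" and b: "below k s" and k: "0 \<le> k" "0 \<le> d" "k + d \<le> 1"
    and a: "a \<le> e i i s"
  shows "k * x i + min (g * d) a \<le> X i (s + 1) - X i s"
proof -
  have "min (lam i * (s + 1 - s)) (e i i s + k * x i * (s + 1 - s)) \<le> X i (s + 1) - X i s"
    using s k below_invariant[OF s _ b] by (intro X_diff_ge J_diff_ge_below kx_le_lam) auto
  then show ?thesis using level_le_lam[OF k(2,3), of i] a by simp
qed

text \<open>One factor \<open>g\<close> for the share \<open>P i j\<close>, one for survival until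
  the end of the window.\<close>

lemma f_gain:
  assumes s: "0 \<le> s" and b: "below k s" and k: "0 \<le> k" "k \<le> 1"
    and a: "0 \<le> a" "k * x i + a \<le> X i (s + 1) - X i s"
  shows "k * fs i j + g ^ 2 * a \<le> f i j (s + 1)"
proof -
  have "k * fs i j + g * (g * a) \<le> f i j (s + 1)"
  proof (rule f_surplus[OF s _ b k])
    have "g * a \<le> P i j * (X i (s + 1) - X i s - k * x i)"
      using g_bounds(1) g_bounds(5)[of i j] a P_pos[of i j] by (intro mult_mono) auto
    then show "g * a \<le> f i j s - k * fs i j + P i j * (X i (s + 1) - X i s - k * x i * (s + 1 - s))"
      using b unfolding below_def by (simp add: add_increasing)
  qed (use a g_bounds in auto)
  then show ?thesis by (simp add: power2_eq_square mult.assoc)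
qed

text \<open>The empty compartments set the exponent 4: survival in loaded transit, arrival rate, the
  comparison \<open>g * es i j \<le> Q i j\<close>, and survival in empty transit. The loaded ones
  keep \<open>g * a\<close>, which is more than enough as \<open>g * fs i j \<le> 1\<close>.\<close>

lemma below_gain:
  assumes s: "0 \<le> s" and b: "below k s" and k: "0 \<le> k" "k \<le> 1"
    and a: "0 \<le> a" "\<And>i j. k * fs i j + a \<le> f i j s"
  shows "below (k + g ^ 4 * a) (s + 1)"
proof -
  note g0 = g_bounds(1,2)
  have ga: "0 \<le> g * a" using g0 a by simp
  have g4: "g ^ 4 * a * c = g * ((g * a) * (g * c)) * g" for c
    by (simp add: power4_eq_xxxx mult_ac)
  have "(k + g ^ 4 * a) * fs i j \<le> f i j (s + 1)" for i j
  proof -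
    have "(g * a) * (g * fs i j) \<le> (g * a) * 1"
      using ga g_bounds(8) by (intro mult_left_mono)
    moreover have z: "0 \<le> (g * a) * (g * fs i j)"
      using g0 a fs_pos[of i j] by (intro mult_nonneg_nonneg) auto
    moreover have "g * ((g * a) * (g * fs i j)) \<le> (g * a) * (g * fs i j)"
      using g0 z by (intro mult_left_le_one_le) auto
    moreover have "g * ((g * a) * (g * fs i j)) * g \<le> g * ((g * a) * (g * fs i j))"
      using g0 z by (intro mult_right_le_one_le mult_nonneg_nonneg[of g]) auto
    ultimately have "g * ((g * a) * (g * fs i j)) * g \<le> g * a"
      by linarith
    moreover have "k * fs i j + g * a \<le> f i j (s + 1)"
      using f_surplus_persists[OF s _ b k a(1) a(2)] by simp
    ultimately show ?thesis by (simp add: distrib_right g4)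
  qed
  moreover have "(k + g ^ 4 * a) * es i j \<le> e i j (s + 1)" for i j
  proof (cases "i = j")
    case True
    then show ?thesis using e_nonneg[of "s + 1" i j] s by (simp add: es_def)
  next
    case False
    have "(\<Sum>l\<in>UNIV. mu l i * (k * fs l i + g * a)) * (s + 1 - s) \<le> Y i (s + 1) - Y i s"
      using s f_surplus_persists[OF s _ b k a(1) a(2)] by (intro Y_diff_ge) auto
    moreover have "(\<Sum>l\<in>UNIV. mu l i * (k * fs l i + g * a)) = k * y i + (\<Sum>l\<in>UNIV. mu l i) * (g * a)"
    proof -
      have "(\<Sum>l\<in>UNIV. mu l i * (k * fs l i + g * a)) = (\<Sum>l\<in>UNIV. k * (mu l i * fs l i) + mu l i * (g * a))"
        by (intro sum.cong) (auto simp: algebra_simps)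
      then show ?thesis
        by (simp add: sum.distrib sum_mu_fs flip: sum_distrib_left sum_distrib_right)
    qed
    moreover have "g * (g * a) \<le> (\<Sum>l\<in>UNIV. mu l i) * (g * a)"
    proof (intro mult_right_mono ga)
      have "mu i i \<le> (\<Sum>l\<in>UNIV. mu l i)"
        using mu_pos by (intro member_le_sum) (auto simp: less_imp_le)
      then show "g \<le> (\<Sum>l\<in>UNIV. mu l i)" using g_bounds(4)[of i i] by linarith
    qed
    ultimately have "g * (g * a) \<le> Y i (s + 1) - Y i s - k * y i" by simp
    then have "(g * es i j) * (g * (g * a)) \<le> Q i j * (Y i (s + 1) - Y i s - k * y i * (s + 1 - s))"
      using g_bounds(9)[of i j] ga g0 Q_nonneg by (intro mult_mono) auto
    then have "k * es i j + g * ((g * es i j) * (g * (g * a))) \<le> e i j (s + 1)"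
      using b ga g0 es_nonneg[of i j] unfolding below_def
      by (intro e_surplus[OF s _ b k False]) (auto intro: add_increasing)
    then show ?thesis by (simp add: power4_eq_xxxx algebra_simps)
  qed
  ultimately show ?thesis
    unfolding below_def by simp
qed

end

section \<open>Total load, mass surplus and the limiting level\<close>

definition F :: real where
  "F = (\<Sum>i\<in>UNIV. \<Sum>j\<in>UNIV. es i j + fs i j)"

definition c :: real where
  "c = min 1 (1 / F)"

lemma F_pos: "0 < F"
  unfolding F_def using fs_pos es_nonneg by (intro sum_pos) (auto simp: add_nonneg_pos)

lemma c_bounds: "0 < c" "c \<le> 1" "c * F \<le> 1"
  unfolding c_def using F_pos by (auto simp: min_mult_distrib_right field_simps min_def)

lemma mass_surplus:
  assumes "0 \<le> t"
  shows "(\<Sum>i\<in>UNIV. \<Sum>j\<in>UNIV. (e i j t - k * es i j) + (f i j t - k * fs i j)) = 1 - k * F"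
  using mass[OF assms] by (simp add: F_def sum.distrib sum_subtractf sum_distrib_left algebra_simps)

text \<open>Pigeonhole: the total surplus \<open>1 - k * F\<close> is at least \<open>d * F\<close>
  since \<open>c * F \<le> 1\<close>, and it is shared by \<open>2 * N\<close> compartments. As
  \<open>es i i = 0\<close>, a queue counts with its whole content.\<close>

lemma surplus_exists:
  assumes t: "0 \<le> t" and d: "c = k + d"
  defines "N \<equiv> real (CARD('r) * CARD('r))"
  obtains i j where "k * es i j + d * (F / (2 * N)) \<le> e i j t"
    | i j where "k * fs i j + d * (F / (2 * N)) \<le> f i j t"
proof -
  let ?b = "d * (F / (2 * N))"
  have "\<exists>i j. k * es i j + ?b \<le> e i j t \<or> k * fs i j + ?b \<le> f i j t"
  proof (rule ccontr)
    assume "\<not> ?thesis"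
    then have *: "(e i j t - k * es i j) + (f i j t - k * fs i j) < 2 * ?b" for i j
      by (smt (verit))
    have "(\<Sum>i\<in>(UNIV::'r set). \<Sum>j\<in>(UNIV::'r set). (e i j t - k * es i j) + (f i j t - k * fs i j))
      < (\<Sum>i\<in>(UNIV::'r set). \<Sum>j\<in>(UNIV::'r set). 2 * ?b)"
      by (intro sum_strict_mono *) auto
    also have "\<dots> = d * F" by (simp add: N_def)
    finally show False
      unfolding mass_surplus[OF t] using c_bounds(3) unfolding d by (simp add: distrib_right)
  qed
  then show ?thesis using that by blast
qed

text \<open>
  Mass conservation provides a surplus of order \<open>c - k\<close> somewhere. Since \<open>P > 0\<close> and
  \<open>Q i i > 0\<close>, it spreads to every compartment within three units of time.
\<close>

lemma below_contracts:
  obtains \<theta> where "0 < \<theta>" "\<theta> < 1"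
    "\<And>s k. 0 \<le> s \<Longrightarrow> 0 \<le> k \<Longrightarrow> k \<le> c \<Longrightarrow> below k s \<Longrightarrow> below (k + \<theta> * (c - k)) (s + 3)"
proof -
  obtain g where g: "rate_bound g" using rate_bound_exists ..
  note g0 = g_bounds(1,2)[OF g]
  define \<eta>0 where "\<eta>0 = F / (2 * real (CARD('r) * CARD('r)))"
  have h0: "0 < \<eta>0" unfolding \<eta>0_def using F_pos by simp
  \<comment> \<open>First unit of time: one station gains departures. The terms are the capacity
    cap, a surplus found in transit and a surplus found in a queue.\<close>
  define \<eta>1 where "\<eta>1 = min g (min (g ^ 3 * \<eta>0) \<eta>0)"
  have h1: "0 < \<eta>1" "\<eta>1 \<le> g" "\<eta>1 \<le> g ^ 3 * \<eta>0" "\<eta>1 \<le> \<eta>0"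
    unfolding \<eta>1_def using g0 h0 by auto
  \<comment> \<open>Second unit: that station feeds every \<open>j\<close> since all
    \<open>P i j\<close> are positive, so every station gains departures. \<open>\<theta>\<close>
    then adds the losses of \<open>f_gain\<close> and, for the third unit, of
    \<open>below_gain\<close>.\<close>
  define \<eta>2 where "\<eta>2 = min g (g ^ 3 * (g ^ 2 * \<eta>1))"
  have h2: "0 < \<eta>2" "\<eta>2 \<le> g" "\<eta>2 \<le> g ^ 3 * (g ^ 2 * \<eta>1)"
    unfolding \<eta>2_def using g0 h1 by auto
  define \<theta> where "\<theta> = g ^ 4 * (g ^ 2 * \<eta>2)"
  have "0 < \<theta>" unfolding \<theta>_def using g0 h2 by simp
  moreover have "\<theta> < 1"
  proof -
    have "g ^ 2 * \<eta>2 \<le> 1 * \<eta>2" using g0 h2 by (intro mult_right_mono power_le_one) auto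
    then have "g ^ 4 * (g ^ 2 * \<eta>2) \<le> 1 * \<eta>2" using g0 h2 by (intro mult_mono power_le_one) auto
    then show ?thesis unfolding \<theta>_def using g0 h2 by linarith
  qed
  moreover have "below (k + \<theta> * (c - k)) (s + 3)" if s: "0 \<le> s" and k: "0 \<le> k" "k \<le> c" and b: "below k s" for s k
  proof -
    define d where "d = c - k"
    have d: "0 \<le> d" "k + d \<le> 1" "c = k + d" "k \<le> 1" using k c_bounds by (auto simp: d_def)
    have b': "below k r" if "s \<le> r" for r
      using below_invariant[OF s that b] k d by simp
    have le: "\<eta> * d \<le> z * d" if "\<eta> \<le> z" for \<eta> z using that d by (intro mult_right_mono)
    have "\<exists>i. k * x i + \<eta>1 * d \<le> X i (s + 1) - X i s"
      using surplus_exists[OF s d(3), folded \<eta>0_def]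
    proof cases
      case (1 i j)
      show ?thesis
      proof (cases "i = j")
        case True
        have "k * x i + min (g * d) (d * \<eta>0) \<le> X i (s + 1) - X i s"
          using 1 True by (intro X_gain_queue[OF g s b k(1) d(1,2)]) (simp add: es_def)
        moreover have "\<eta>1 * d \<le> min (g * d) (d * \<eta>0)"
          using le[OF h1(2)] le[OF h1(4)] by (simp add: mult_ac)
        ultimately show ?thesis by (intro exI[of _ i]) linarith
      next
        case False
        have "k * x j + min (g * d) (g ^ 3 * (d * \<eta>0)) \<le> X j (s + 1) - X j s"
          using 1 False h0 d by (intro X_gain_flow[OF g s b k(1) d(1,2), of _ i]) auto
        moreover have "\<eta>1 * d \<le> min (g * d) (g ^ 3 * (d * \<eta>0))"
          using le[OF h1(2)] le[OF h1(3)] by (simp add: mult_ac)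
        ultimately show ?thesis by (intro exI[of _ j]) linarith
      qed
    next
      case (2 i j)
      have "k * x j + min (g * d) (g ^ 3 * (d * \<eta>0)) \<le> X j (s + 1) - X j s"
        using 2 h0 d by (intro X_gain_flow[OF g s b k(1) d(1,2), of _ i]) auto
      moreover have "\<eta>1 * d \<le> min (g * d) (g ^ 3 * (d * \<eta>0))"
        using le[OF h1(2)] le[OF h1(3)] by (simp add: mult_ac)
      ultimately show ?thesis by (intro exI[of _ j]) linarith
    qed
    then obtain i where i: "k * x i + \<eta>1 * d \<le> X i (s + 1) - X i s" ..
    have f1: "k * fs i j + g ^ 2 * (\<eta>1 * d) \<le> f i j (s + 1)" for j
      using i h1 d by (intro f_gain[OF g s b k(1)]) auto
    have f2: "k * fs j l + g ^ 2 * (\<eta>2 * d) \<le> f j l (s + 1 + 1)" for j l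
    proof (rule f_gain[OF g])
      have "k * x j + min (g * d) (g ^ 3 * (g ^ 2 * (\<eta>1 * d))) \<le> X j (s + 1 + 1) - X j (s + 1)"
        using f1[of j] s b'[of "s + 1"] h1 d k g0 by (intro X_gain_flow[OF g, of _ _ d _ i]) auto
      moreover have "\<eta>2 * d \<le> min (g * d) (g ^ 3 * (g ^ 2 * (\<eta>1 * d)))"
        using le[OF h2(2)] le[OF h2(3)] by (simp add: mult_ac)
      ultimately show "k * x j + \<eta>2 * d \<le> X j (s + 1 + 1) - X j (s + 1)" by linarith
    qed (use s b' k d h2 in auto)
    have "below (k + g ^ 4 * (g ^ 2 * (\<eta>2 * d))) (s + 1 + 1 + 1)"
      using f2 s b' k d h2 g0 by (intro below_gain[OF g]) auto
    then show ?thesis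
      unfolding \<theta>_def d_def by (simp add: mult_ac add.assoc)
  qed
  ultimately show ?thesis by (rule that)
qed

lemma below_exponential:
  obtains D \<gamma> where "0 \<le> D" "0 < \<gamma>" "\<And>t. 0 \<le> t \<Longrightarrow> below (c - D * exp (- \<gamma> * t)) t"
proof -
  obtain \<theta> where th: "0 < \<theta>" "\<theta> < 1" and
    step: "\<And>s k. 0 \<le> s \<Longrightarrow> 0 \<le> k \<Longrightarrow> k \<le> c \<Longrightarrow> below k s \<Longrightarrow> below (k + \<theta> * (c - k)) (s + 3)"
    using below_contracts by blast
  define q where "q = 1 - \<theta>"
  have q: "0 < q" "q < 1" using th by (auto simp: q_def)
  \<comment> \<open>The deficit shrinks by the factor \<open>q\<close> every three units of time, so
    \<open>exp (- 3 * \<gamma>) = q\<close>.\<close>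
  define \<gamma> where "\<gamma> = - ln q / 3"
  have \<gamma>: "0 < \<gamma>" using q by (simp add: \<gamma>_def)
  have qn: "0 \<le> c * q ^ n" "c * q ^ n \<le> c" for n
    using q c_bounds by (auto intro: mult_left_le power_le_one)
  have bn: "below (c - c * q ^ n) (3 * real n)" for n
  proof (induction n)
    case 0
    show ?case using e_nonneg f_nonneg by (auto simp: below_def)
  next
    case (Suc n)
    have "below (c - c * q ^ n + \<theta> * (c - (c - c * q ^ n))) (3 * real n + 3)"
      using Suc qn[of n] by (intro step) auto
    moreover have "c - c * q ^ n + \<theta> * (c - (c - c * q ^ n)) = c - c * q ^ Suc n"
      by (simp add: q_def algebra_simps)
    moreover have "3 * real n + 3 = 3 * real (Suc n)" by simp
    ultimately show ?case by metis
  qed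
  \<comment> \<open>Dividing by \<open>q\<close> pays for the time since the last multiple of 3,
    during which the level merely persists.\<close>
  have "below (c - c / q * exp (- \<gamma> * t)) t" if t: "0 \<le> t" for t
  proof -
    define n where "n = nat \<lfloor>t / 3\<rfloor>"
    have n: "real n \<le> t / 3" "t / 3 < real n + 1"
      using t by (auto simp: n_def) linarith+
    have "below (c - c * q ^ n) t"
      using n(1) qn[of n] c_bounds by (intro below_invariant[OF _ _ bn[of n]]) auto
    moreover have "q ^ n \<le> exp (- \<gamma> * t) / q"
    proof -
      have "q ^ n * q = q powr (real n + 1)" using q by (simp add: powr_add powr_realpow)
      also have "\<dots> \<le> q powr (t / 3)" using q n by (intro powr_mono') auto
      also have "\<dots> = exp (- \<gamma> * t)" using q by (simp add: powr_def \<gamma>_def)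
      finally show ?thesis using q by (simp add: field_simps)
    qed
    then have "c * q ^ n \<le> c * (exp (- \<gamma> * t) / q)"
      using c_bounds by (intro mult_left_mono) auto
    ultimately show ?thesis by (elim below_mono) simp
  qed
  moreover have "0 \<le> c / q" using q c_bounds by simp
  ultimately show ?thesis using that \<gamma> by blast
qed

subsection \<open>Convergence\<close>

text \<open>Here \<open>c * F = 1\<close>, so the surpluses above the level
  \<open>c - D * exp (- \<gamma> * t)\<close> are nonnegative and add up to only
  \<open>D * exp (- \<gamma> * t) * F\<close>. For \<open>i = j\<close> the second claim says that
  the queues empty.\<close>

lemma tendsto_critical:
  assumes "1 \<le> F"
  shows "(f i j \<longlongrightarrow> c * fs i j) at_top" "(e i j \<longlongrightarrow> c * es i j) at_top"
proof -
  obtain D \<gamma> where D: "0 \<le> D" "0 < \<gamma>" and b: "\<And>t. 0 \<le> t \<Longrightarrow> below (c - D * exp (- \<gamma> * t)) t"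
    using below_exponential by blast
  have cF: "c * F = 1" using assms by (simp add: c_def min_def)
  let ?k = "\<lambda>t. c - D * exp (- \<gamma> * t)"
  have lim: "((\<lambda>t. ?k t * z) \<longlongrightarrow> c * z) at_top" "((\<lambda>t. ?k t * z + D * exp (- \<gamma> * t) * F) \<longlongrightarrow> c * z) at_top" for z
    by (rule tendsto_eq_intros tendsto_exp_decay[OF D(2)] refl | simp)+
  have bounds: "?k t * fs i j \<le> f i j t \<and> f i j t \<le> ?k t * fs i j + D * exp (- \<gamma> * t) * F \<and>
      ?k t * es i j \<le> e i j t \<and> e i j t \<le> ?k t * es i j + D * exp (- \<gamma> * t) * F" if t: "0 \<le> t" for t
  proof -
    have nn: "0 \<le> f i j t - ?k t * fs i j" "0 \<le> e i j t - ?k t * es i j" for i j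
      using b[OF t] unfolding below_def by auto
    have "(e i j t - ?k t * es i j) + (f i j t - ?k t * fs i j)
      \<le> (\<Sum>j\<in>UNIV. (e i j t - ?k t * es i j) + (f i j t - ?k t * fs i j))"
      by (intro member_le_sum add_nonneg_nonneg nn) auto
    also have "\<dots> \<le> (\<Sum>i\<in>UNIV. \<Sum>j\<in>UNIV. (e i j t - ?k t * es i j) + (f i j t - ?k t * fs i j))"
      by (intro member_le_sum[where f="\<lambda>i. \<Sum>j\<in>UNIV. (e i j t - ?k t * es i j) + (f i j t - ?k t * fs i j)"]
          sum_nonneg add_nonneg_nonneg nn) auto
    also have "\<dots> = D * exp (- \<gamma> * t) * F"
      unfolding mass_surplus[OF t] using cF by (simp add: left_diff_distrib)
    finally show ?thesis using nn[of i j] by linarith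
  qed
  show "(f i j \<longlongrightarrow> c * fs i j) at_top"
    by (rule tendsto_sandwich[OF _ _ lim(1) lim(2)];
        rule eventually_mono[OF eventually_ge_at_top[of 0]]; use bounds in blast)
  show "(e i j \<longlongrightarrow> c * es i j) at_top"
    by (rule tendsto_sandwich[OF _ _ lim(1) lim(2)];
        rule eventually_mono[OF eventually_ge_at_top[of 0]]; use bounds in blast)
qed

text \<open>
  Below the critical mass, the queue at a station \<open>i0\<close> with \<open>x i0 = lam i0\<close> integrates the excess
  inflow into \<open>i0\<close> and is at most 1. As the deficits are integrable, so are the excesses
  of all \<open>f k i0\<close>, then of the departures \<open>X k\<close>, and then of everything else.
\<close>

lemma tendsto_subcritical:
  assumes "F < 1"
  shows "(f i j \<longlongrightarrow> fs i j) at_top" "i \<noteq> j \<Longrightarrow> (e i j \<longlongrightarrow> es i j) at_top"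
proof -
  obtain D \<gamma> where D: "0 \<le> D" "0 < \<gamma>" and b: "\<And>t. 0 \<le> t \<Longrightarrow> below (c - D * exp (- \<gamma> * t)) t"
    using below_exponential by blast
  have c1: "c = 1" using assms F_pos by (simp add: c_def)
  have f_low: "fs i j - D * fs i j * exp (- \<gamma> * t) \<le> f i j t" if "0 \<le> t" for i j t
    using b[OF that] unfolding below_def c1 by (simp add: algebra_simps)
  have e_low: "es i j - D * es i j * exp (- \<gamma> * t) \<le> e i j t" if "0 \<le> t" for i j t
    using b[OF that] unfolding below_def c1 by (simp add: algebra_simps)
  \<comment> \<open>Accumulated excess of the flow through a compartment over its equilibrium value.
    The constants \<open>bf\<close> and \<open>be\<close> below integrate the exponential deficits
    over all time.\<close>
  define F' where "F' i j t = mu i j * (integral {0..t} (f i j) - fs i j * t)" for i j t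
  define E' where "E' i j t = mu i j * (integral {0..t} (e i j) - es i j * t)" for i j t
  define bf where "bf i j = mu i j * (D * fs i j / \<gamma>)" for i j
  define be where "be i j = mu i j * (D * es i j / \<gamma>)" for i j
  have F'_ge: "- bf i j \<le> F' i j t" if "0 \<le> t" for i j t
  proof -
    have "fs i j * (t - 0) + D * fs i j / \<gamma> * (exp (- \<gamma> * t) - exp (- \<gamma> * 0)) \<le> integral {0..t} (f i j)"
      using that D f_low by (intro integral_ge_exp continuous_on_subset[OF cont_f]) auto
    moreover have "0 \<le> D * fs i j / \<gamma> * exp (- \<gamma> * t)"
      using D fs_pos[of i j] by simp
    ultimately have "fs i j * t - D * fs i j / \<gamma> \<le> integral {0..t} (f i j)"
      by (simp add: right_diff_distrib)
    then have "mu i j * (- (D * fs i j / \<gamma>)) \<le> F' i j t"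
      unfolding F'_def using mu_pos[of i j] by (intro mult_left_mono) auto
    then show ?thesis by (simp add: bf_def)
  qed
  have E'_ge: "- be i j \<le> E' i j t" if "0 \<le> t" for i j t
  proof -
    have "es i j * (t - 0) + D * es i j / \<gamma> * (exp (- \<gamma> * t) - exp (- \<gamma> * 0)) \<le> integral {0..t} (e i j)"
      using that D e_low by (intro integral_ge_exp continuous_on_subset[OF cont_e]) auto
    moreover have "0 \<le> D * es i j / \<gamma> * exp (- \<gamma> * t)"
      using D es_nonneg[of i j] by simp
    ultimately have "es i j * t - D * es i j / \<gamma> \<le> integral {0..t} (e i j)"
      by (simp add: right_diff_distrib)
    then have "mu i j * (- (D * es i j / \<gamma>)) \<le> E' i j t"
      unfolding E'_def using mu_pos[of i j] by (intro mult_left_mono) auto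
    then show ?thesis by (simp add: be_def)
  qed
  have Y_F': "Y i t - Y i 0 - y i * t = (\<Sum>k\<in>UNIV. F' k i t)" if "0 \<le> t" for i t
    using Y_diff[OF order_refl that, of i]
    by (simp add: F'_def right_diff_distrib sum_subtractf sum_mu_fs flip: mult.assoc sum_distrib_right)
  have J_F': "J i t - J i 0 - x i * t = (\<Sum>k\<in>UNIV - {i}. E' k i t) + Q i i * (\<Sum>k\<in>UNIV. F' k i t)" if "0 \<le> t" for i t
  proof -
    have "(\<Sum>k\<in>UNIV - {i}. E' k i t) = (\<Sum>k\<in>UNIV - {i}. mu k i * integral {0..t} (e k i)) - (\<Sum>k\<in>UNIV - {i}. mu k i * es k i) * t"
      by (simp add: E'_def right_diff_distrib sum_subtractf flip: mult.assoc sum_distrib_right)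
    then show ?thesis
      using J_diff[OF order_refl that, of i] unfolding x_balance[of i, symmetric] Y_F'[OF that, symmetric]
      by (simp add: algebra_simps)
  qed
  have f_F': "f i j t - f i j 0 = P i j * (X i t - X i 0 - x i * t) - F' i j t" if "0 \<le> t" for i j t
    using f_diff[OF order_refl that, of i j] mu_fs[of i j]
    by (simp add: F'_def right_diff_distrib flip: mult.assoc)
  have e_E': "e i j t - e i j 0 = Q i j * (Y i t - Y i 0 - y i * t) - E' i j t" if "0 \<le> t" "i \<noteq> j" for i j t
    using e_diff[OF order_refl that] mu_es[OF that(2)]
    by (simp add: E'_def right_diff_distrib flip: mult.assoc)
  note bnd = e_nonneg f_nonneg entry_le_1
  obtain i0 where i0: "x i0 = lam i0" using x_tight ..
  define K0 where "K0 = (1 + (\<Sum>k\<in>UNIV - {i0}. be k i0)) / Q i0 i0"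
  have S: "(\<Sum>k\<in>UNIV. F' k i0 t) \<le> K0" if t: "0 \<le> t" for t
  proof -
    \<comment> \<open>Departures from \<open>i0\<close> cannot exceed
      \<open>lam i0 * t = x i0 * t\<close>, so excess inflow piles up in the queue, which holds at
      most 1.\<close>
    have "J i0 t - J i0 0 - x i0 * t \<le> 1"
      using e_diag_diff[OF order_refl t, of i0] X_le[OF order_refl t, of i0] bnd(1)[OF order_refl, of i0 i0]
        bnd(3)[OF t, of i0 i0] i0 by simp
    moreover have "(\<Sum>k\<in>UNIV - {i0}. - be k i0) \<le> (\<Sum>k\<in>UNIV - {i0}. E' k i0 t)"
      using E'_ge t by (intro sum_mono)
    ultimately have "Q i0 i0 * (\<Sum>k\<in>UNIV. F' k i0 t) \<le> 1 + (\<Sum>k\<in>UNIV - {i0}. be k i0)"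
      using J_F'[OF t, of i0] by (simp add: sum_negf)
    then show ?thesis
      using Q_diag[of i0] by (simp add: K0_def pos_le_divide_eq mult.commute)
  qed
  \<comment> \<open>Since \<open>P k i0 > 0\<close>, excess departures from any \<open>k\<close>
    show up on the single edge into \<open>i0\<close>.\<close>
  define K1 where "K1 k = (1 + (K0 + (\<Sum>m\<in>UNIV - {k}. bf m i0))) / P k i0" for k
  have X1: "X k t - X k 0 - x k * t \<le> K1 k" if t: "0 \<le> t" for k t
  proof -
    have "F' k i0 t \<le> K0 + (\<Sum>m\<in>UNIV - {k}. bf m i0)"
      using S[OF t] F'_ge[OF t] by (intro sum_term_le) auto
    then have "P k i0 * (X k t - X k 0 - x k * t) \<le> 1 + (K0 + (\<Sum>m\<in>UNIV - {k}. bf m i0))"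
      using f_F'[OF t, of k i0] bnd(2)[OF order_refl, of k i0] bnd(4)[OF t, of k i0] by linarith
    then show ?thesis
      using P_pos[of k i0] by (simp add: K1_def pos_le_divide_eq mult.commute)
  qed
  have F1: "F' i j t \<le> P i j * K1 i + 1" if t: "0 \<le> t" for i j t
  proof -
    have "P i j * (X i t - X i 0 - x i * t) \<le> P i j * K1 i"
      using X1[OF t] P_pos[of i j] by (intro mult_left_mono) auto
    then show ?thesis
      using f_F'[OF t, of i j] bnd(2)[OF t, of i j] bnd(4)[OF order_refl, of i j] by linarith
  qed
  have "((\<lambda>t. f i j t - fs i j) \<longlongrightarrow> 0) at_top"
  proof (rule integral_bounded_imp_tendsto_0[OF _ D(2)])
    show "\<bar>f i j t - fs i j - (f i j s - fs i j)\<bar> \<le> (P i j * lam i + mu i j) * (t - s)" if "0 \<le> s" "s \<le> t" for s t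
      using f_lipschitz[OF that, of i j] by simp
    show "0 \<le> D * fs i j" using D fs_pos[of i j] by simp
    show "- (D * fs i j * exp (- \<gamma> * t)) \<le> f i j t - fs i j" if "0 \<le> t" for t
      using f_low[OF that, of i j] by simp
    show "integral {0..t} (\<lambda>t. f i j t - fs i j) \<le> (P i j * K1 i + 1) / mu i j" if "0 \<le> t" for t
      using F1[OF that, of i j] mu_pos[of i j]
      by (simp add: integral_minus_const[OF that cont_f] F'_def pos_le_divide_eq mult.commute)
  qed
  then show "(f i j \<longlongrightarrow> fs i j) at_top"
    by (simp add: LIM_zero_iff)
  assume ij: "i \<noteq> j"
  have E1: "E' i j t \<le> Q i j * (\<Sum>k\<in>UNIV. P k i * K1 k + 1) + 1" if t: "0 \<le> t" for t
  proof -
    have "Q i j * (Y i t - Y i 0 - y i * t) \<le> Q i j * (\<Sum>k\<in>UNIV. P k i * K1 k + 1)"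
      unfolding Y_F'[OF t] using Q_nonneg[of i j] F1[OF t] by (intro mult_left_mono sum_mono)
    then show ?thesis
      using e_E'[OF t ij] bnd(1)[OF t, of i j] bnd(3)[OF order_refl, of i j] by linarith
  qed
  have "((\<lambda>t. e i j t - es i j) \<longlongrightarrow> 0) at_top"
  proof (rule integral_bounded_imp_tendsto_0[OF _ D(2)])
    show "\<bar>e i j t - es i j - (e i j s - es i j)\<bar> \<le> (Q i j * (\<Sum>k\<in>UNIV. mu k i) + mu i j) * (t - s)" if "0 \<le> s" "s \<le> t" for s t
      using e_lipschitz[OF that ij] by simp
    show "0 \<le> D * es i j" using D es_nonneg[of i j] by simp
    show "- (D * es i j * exp (- \<gamma> * t)) \<le> e i j t - es i j" if "0 \<le> t" for t
      using e_low[OF that, of i j] by simp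
    show "integral {0..t} (\<lambda>t. e i j t - es i j) \<le> (Q i j * (\<Sum>k\<in>UNIV. P k i * K1 k + 1) + 1) / mu i j" if "0 \<le> t" for t
      using E1[OF that] mu_pos[of i j]
      by (simp add: integral_minus_const[OF that cont_e] E'_def pos_le_divide_eq mult.commute)
  qed
  then show "(e i j \<longlongrightarrow> es i j) at_top"
    by (simp add: LIM_zero_iff)
qed

lemma f_tendsto: "(f i j \<longlongrightarrow> c * fs i j) at_top"
proof (cases "1 \<le> F")
  case False
  then have "c = 1" using F_pos by (simp add: c_def)
  then show ?thesis using False tendsto_subcritical(1)[of i j] by simp
qed (rule tendsto_critical)

lemma e_tendsto:
  assumes "i \<noteq> j"
  shows "(e i j \<longlongrightarrow> c * es i j) at_top"
proof (cases "1 \<le> F")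
  case False
  then have "c = 1" using F_pos by (simp add: c_def)
  then show ?thesis using False tendsto_subcritical(2)[OF _ assms] by simp
qed (rule tendsto_critical)

text \<open>While the queue at \<open>i\<close> is nonempty, \<open>X i\<close> grows at rate \<open>lam i > c * x i\<close>, which would be visible in \<open>f i i\<close>.\<close>

lemma queue_tendsto:
  assumes "c * x i < lam i"
  shows "(e i i \<longlongrightarrow> 0) at_top"
proof (rule order_tendstoI)
  fix a :: real assume "a < 0"
  then show "eventually (\<lambda>t. a < e i i t) at_top"
    by (intro eventually_mono[OF eventually_ge_at_top[of 0]] less_le_trans[OF _ e_nonneg])
next
  fix \<eta> :: real assume eta: "0 < \<eta>"
  \<comment> \<open>A queue of at least \<open>\<eta>\<close> stays positive for time
    \<open>h\<close>, as it drains at rate at most \<open>lam i\<close>.\<close>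
  define h where "h = \<eta> / (2 * lam i)"
  have h: "0 < h" "lam i * h = \<eta> / 2" using eta lam_pos[of i] by (auto simp: h_def)
  \<comment> \<open>\<open>p\<close> is the excess input into \<open>f i i\<close> during such a
    busy period. Being \<open>\<delta>\<close>-close to the limit at both ends (the 2 in
    \<open>m\<close>) and throughout (\<open>mu i i * h\<close>) leaves room for at most
    \<open>\<delta> * m\<close>.\<close>
  define p where "p = P i i * (lam i - c * x i) * h"
  have p: "0 < p" using assms h P_pos[of i i] by (simp add: p_def)
  define m where "m = 2 + mu i i * h"
  define \<delta> where "\<delta> = p / 2 / m"
  have "0 < m" unfolding m_def using mu_pos[of i i] h by (intro add_pos_pos) auto
  then have \<delta>: "0 < \<delta>" "\<delta> * m = p / 2" using p by (auto simp: \<delta>_def)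
  have "eventually (\<lambda>t. dist (f i i t) (c * fs i i) < \<delta>) at_top"
    using f_tendsto \<delta>(1) by (rule tendstoD)
  then obtain t0 where t0: "\<And>t. t0 \<le> t \<Longrightarrow> \<bar>f i i t - c * fs i i\<bar> < \<delta>"
    by (auto simp: eventually_at_top_linorder dist_real_def)
  show "eventually (\<lambda>t. e i i t < \<eta>) at_top"
    using eventually_ge_at_top[of "max 0 t0"]
  proof eventually_elim
    case (elim t)
    show ?case
    proof (rule ccontr)
      assume "\<not> ?case"
      have t: "0 \<le> t" "t \<le> t + h" using elim h by auto
      have "X i (t + h) - X i t = lam i * (t + h - t)"
      proof (rule X_busy[OF t])
        fix r assume r: "t < r" "r \<le> t + h"
        then have "e i i r \<ge> e i i t - lam i * (r - t)" using t by (intro e_diag_ge) auto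
        moreover have "lam i * (r - t) \<le> lam i * h" using r lam_pos[of i] by (intro mult_left_mono) auto
        ultimately show "0 < e i i r" using \<open>\<not> ?case\<close> h eta by linarith
      qed
      then have X: "X i (t + h) - X i t = lam i * h" by simp
      have cont: "continuous_on {t..t + h} (\<lambda>r. - f i i r)"
        using t by (intro continuous_intros continuous_on_subset[OF cont_f]) auto
      have "- (c * fs i i + \<delta>) \<le> - f i i r" if "r \<in> {t..t + h}" for r
        using t0[of r] that elim by (auto simp: abs_less_iff)
      from integral_lower_bound[OF t(2) cont this]
      have "integral {t..t + h} (f i i) \<le> (c * fs i i + \<delta>) * h"
        by (simp add: algebra_simps)
      then have "mu i i * integral {t..t + h} (f i i) \<le> mu i i * ((c * fs i i + \<delta>) * h)"
        using mu_pos[of i i] by (intro mult_left_mono) auto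
      also have "\<dots> = c * (x i * P i i) * h + \<delta> * (mu i i * h)"
        unfolding mu_fs[symmetric] by (simp add: algebra_simps)
      finally have "P i i * (lam i * h) \<le> 2 * \<delta> + c * (x i * P i i) * h + \<delta> * (mu i i * h)"
        using f_diff[OF t, of i i] t0[of t] t0[of "t + h"] elim h(1)
        unfolding X[symmetric] right_diff_distrib by linarith
      then have "p \<le> \<delta> * m" unfolding p_def m_def by (simp add: algebra_simps)
      then show False using \<delta>(2) p by linarith
    qed
  qed
qed

end

subsection \<open>Solutions of the fluid model\<close>

text \<open>The order avoids circularity: primitives of bounded right-continuous paths are
  continuous, so each queue is a continuous function plus \<open>lam $ i * u t $ i\<close> and
  \<open>v_continuous\<close> applies; continuity of \<open>e\<close> and \<open>f\<close> is then
  read off the equations.\<close>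

lemma fluid_solution_flow:
  assumes lam: "\<And>i. lam $ i > 0" and mu: "\<And>i j. mu $ i $ j > 0"
    and Q: "row_stochastic Q"
    and P_pos: "\<And>i j. P $ i $ j > 0" and Q_diag: "\<And>i. Q $ i $ i > 0"
    and sol: "fluid_solution lam mu P Q e f u"
  shows "fluid_flow (\<lambda>i. lam $ i) (\<lambda>i j. mu $ i $ j) (\<lambda>i j. P $ i $ j) (\<lambda>i j. Q $ i $ j)
    (\<lambda>i j t. e t $ i $ j) (\<lambda>i j t. f t $ i $ j) (\<lambda>i t. lam $ i * (t - u t $ i))"
proof -
  note sol' = sol[unfolded fluid_solution_def]
  note tail = sol'[THEN conjunct2, THEN conjunct2, THEN conjunct2]
  note equations = tail[THEN conjunct2, THEN conjunct2]
  note rest = equations[THEN conjunct2, THEN conjunct2, THEN conjunct2]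
  have ss: "(e t, f t) \<in> state_space" if "0 \<le> t" for t
    using tail[THEN conjunct1] that by blast
  have e01: "0 \<le> e t $ i $ j" "e t $ i $ j \<le> 1" if "0 \<le> t" for t i j
    using ss[OF that] by (auto simp: state_space_def)
  have f01: "0 \<le> f t $ i $ j" "f t $ i $ j \<le> 1" if "0 \<le> t" for t i j
    using ss[OF that] by (auto simp: state_space_def)
  have e_right: "((\<lambda>t. e t $ i $ j) \<longlongrightarrow> e t $ i $ j) (at_right t)" if "0 \<le> t" for t i j
    using sol'[THEN conjunct1] that unfolding cadlag_def by (intro tendsto_vec_nth) blast
  have f_right: "((\<lambda>t. f t $ i $ j) \<longlongrightarrow> f t $ i $ j) (at_right t)" if "0 \<le> t" for t i j
    using sol'[THEN conjunct2, THEN conjunct1] that unfolding cadlag_def by (intro tendsto_vec_nth) blast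
  have u_right: "((\<lambda>t. u t $ i) \<longlongrightarrow> u t $ i) (at_right t)" if "0 \<le> t" for t i
    using sol'[THEN conjunct2, THEN conjunct2, THEN conjunct1] that unfolding cadlag_def by (intro tendsto_vec_nth) blast
  have f_eq: "f t $ i $ j = f 0 $ i $ j + lam $ i * P $ i $ j * (t - u t $ i)
          - mu $ i $ j * integral {0..t} (\<lambda>s. f s $ i $ j)" if "0 \<le> t" for t i j
    using equations[THEN conjunct1] that by blast
  have e_eq: "e t $ i $ j = e 0 $ i $ j - mu $ i $ j * integral {0..t} (\<lambda>s. e s $ i $ j)
          + Q $ i $ j * (\<Sum>k\<in>UNIV. mu $ k $ i * integral {0..t} (\<lambda>s. f s $ k $ i))" if "0 \<le> t" "i \<noteq> j" for t i j
    using equations[THEN conjunct2, THEN conjunct1] that by blast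
  have e_diag: "e t $ i $ i = e 0 $ i $ i - lam $ i * (t - u t $ i)
          + (\<Sum>j\<in>UNIV - {i}. mu $ j $ i * integral {0..t} (\<lambda>s. e s $ j $ i))
          + Q $ i $ i * (\<Sum>j\<in>UNIV. mu $ j $ i * integral {0..t} (\<lambda>s. f s $ j $ i))" if "0 \<le> t" for t i
    using equations[THEN conjunct2, THEN conjunct2, THEN conjunct1] that by blast
  have reg: "regulator (\<lambda>t. u t $ i) (\<lambda>t. e t $ i $ i)" for i
  proof
    show "mono_on {0..} (\<lambda>t. u t $ i)"
      using rest[THEN conjunct1] by blast
    show "(\<integral>\<^sup>+ s\<in>{0..}. ennreal (e s $ i $ i) \<partial>interval_measure (\<lambda>s. u (max 0 s) $ i)) = 0"
      using rest[THEN conjunct2, THEN conjunct2] by blast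
  qed (use u_right e_right e01 in auto)
  have int_e: "continuous_on {0..} (\<lambda>t. integral {0..t} (\<lambda>s. e s $ i $ j))" for i j
    by (intro indefinite_integral_continuous_on_Ici right_continuous_integrable[where B=1]) (use e_right e01 in auto)
  have int_f: "continuous_on {0..} (\<lambda>t. integral {0..t} (\<lambda>s. f s $ i $ j))" for i j
    by (intro indefinite_integral_continuous_on_Ici right_continuous_integrable[where B=1]) (use f_right f01 in auto)
  have cont_u: "continuous_on {0..} (\<lambda>t. u t $ i)" for i
  proof (rule regulator.v_continuous[OF reg lam])
    show "continuous_on {0..} (\<lambda>t. e 0 $ i $ i - lam $ i * t
          + (\<Sum>j\<in>UNIV - {i}. mu $ j $ i * integral {0..t} (\<lambda>s. e s $ j $ i))
          + Q $ i $ i * (\<Sum>j\<in>UNIV. mu $ j $ i * integral {0..t} (\<lambda>s. f s $ j $ i)))"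
      by (intro continuous_intros int_e int_f)
    show "e t $ i $ i = (e 0 $ i $ i - lam $ i * t
          + (\<Sum>j\<in>UNIV - {i}. mu $ j $ i * integral {0..t} (\<lambda>s. e s $ j $ i))
          + Q $ i $ i * (\<Sum>j\<in>UNIV. mu $ j $ i * integral {0..t} (\<lambda>s. f s $ j $ i))) + lam $ i * u t $ i"
      if "0 \<le> t" for t
      using e_diag[OF that, of i] by (simp add: right_diff_distrib)
  qed
  have cont_f: "continuous_on {0..} (\<lambda>t. f t $ i $ j)" for i j
  proof -
    have "continuous_on {0..} (\<lambda>t. f 0 $ i $ j + lam $ i * P $ i $ j * (t - u t $ i)
          - mu $ i $ j * integral {0..t} (\<lambda>s. f s $ i $ j))"
      by (intro continuous_intros int_f cont_u)
    then show ?thesis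
      by (rule continuous_on_eq) (rule f_eq[symmetric], simp)
  qed
  have cont_e: "continuous_on {0..} (\<lambda>t. e t $ i $ j)" for i j
  proof (cases "i = j")
    case True
    have "continuous_on {0..} (\<lambda>t. e 0 $ i $ i - lam $ i * (t - u t $ i)
          + (\<Sum>j\<in>UNIV - {i}. mu $ j $ i * integral {0..t} (\<lambda>s. e s $ j $ i))
          + Q $ i $ i * (\<Sum>j\<in>UNIV. mu $ j $ i * integral {0..t} (\<lambda>s. f s $ j $ i)))"
      by (intro continuous_intros int_e int_f cont_u)
    then show ?thesis
      unfolding True[symmetric] by (rule continuous_on_eq) (rule e_diag[symmetric], simp)
  next
    case False
    have "continuous_on {0..} (\<lambda>t. e 0 $ i $ j - mu $ i $ j * integral {0..t} (\<lambda>s. e s $ i $ j)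
          + Q $ i $ j * (\<Sum>k\<in>UNIV. mu $ k $ i * integral {0..t} (\<lambda>s. f s $ k $ i)))"
      by (intro continuous_intros int_e int_f)
    then show ?thesis
      by (rule continuous_on_eq) (rule e_eq[symmetric], use False in simp_all)
  qed
  show ?thesis
  proof
    show "0 \<le> Q $ i $ j" for i j using Q by (simp add: row_stochastic_def)
    show "(\<Sum>i\<in>UNIV. \<Sum>j\<in>UNIV. e t $ i $ j + f t $ i $ j) = 1" if "0 \<le> t" for t
      using ss[OF that] by (simp add: state_space_def)
    show "f t $ i $ j = f 0 $ i $ j + P $ i $ j * (lam $ i * (t - u t $ i))
      - mu $ i $ j * integral {0..t} (\<lambda>s. f s $ i $ j)" if "0 \<le> t" for t i j
      using f_eq[OF that, of i j] by (simp add: mult_ac)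
    show "lam $ i * (t - u t $ i) - lam $ i * (s - u s $ i) \<le> lam $ i * (t - s)" if "0 \<le> s" "s \<le> t" for s t i
      using mono_onD[OF regulator.v_mono[OF reg], of s t i] that lam[of i]
      by (simp flip: right_diff_distrib)
    show "lam $ i * (t - u t $ i) - lam $ i * (s - u s $ i) = lam $ i * (t - s)"
      if "0 \<le> s" "s \<le> t" "\<And>r. s < r \<Longrightarrow> r \<le> t \<Longrightarrow> 0 < e r $ i $ i" for s t i
      using regulator.v_constant[OF reg that(1,2), of i] that(3) by (simp flip: right_diff_distrib)
  qed (rule lam mu P_pos Q_diag cont_e cont_f e01 f01 e_eq e_diag; assumption)+
qed

text \<open>\<open>P ** Q\<close> is entrywise positive because \<open>Q $ j $ j > 0\<close> keeps
  the term \<open>k = j\<close>. Scaling by the smallest ratio \<open>lam $ i / z i\<close> makes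
  its minimizer a bottleneck.\<close>

lemma scaled_stationary_vector:
  fixes lam :: "real^('r::finite)"
  assumes lam: "\<And>i. lam $ i > 0"
    and P: "row_stochastic P" and Q: "row_stochastic Q"
    and P_pos: "\<And>i j. P $ i $ j > 0" and Q_diag: "\<And>i. Q $ i $ i > 0"
  obtains x :: "'r \<Rightarrow> real" where "\<And>i. 0 < x i"
    "\<And>i. x i = (\<Sum>k\<in>UNIV. (\<Sum>l\<in>UNIV. x l * P $ l $ k) * Q $ k $ i)"
    "\<And>i. x i \<le> lam $ i" "\<exists>i. x i = lam $ i"
proof -
  have Q0: "0 \<le> Q $ i $ j" for i j using Q by (simp add: row_stochastic_def)
  have "0 < (P ** Q) $ i $ j" for i j
  proof -
    have "0 < P $ i $ j * Q $ j $ j" using P_pos Q_diag by simp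
    also have "\<dots> \<le> (\<Sum>k\<in>UNIV. P $ i $ k * Q $ k $ j)"
      using P_pos[THEN less_imp_le] Q0 by (intro member_le_sum[where f="\<lambda>k. P $ i $ k * Q $ k $ j"]) auto
    finally show ?thesis by (simp add: matrix_matrix_mult_def)
  qed
  moreover have "(\<Sum>j\<in>UNIV. (P ** Q) $ i $ j) = 1" for i
    using P Q unfolding row_stochastic_def matrix_matrix_mult_def
    by (simp, subst sum.swap) (simp flip: sum_distrib_left)
  ultimately obtain z :: "'r \<Rightarrow> real" where z: "\<And>i. 0 < z i" "\<And>j. (\<Sum>i\<in>UNIV. z i * (P ** Q) $ i $ j) = z j"
    by (rule positive_stationary_vector) (rule that)
  have z_eq: "z i = (\<Sum>k\<in>UNIV. (\<Sum>l\<in>UNIV. z l * P $ l $ k) * Q $ k $ i)" for i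
  proof -
    have "z i = (\<Sum>l\<in>UNIV. \<Sum>k\<in>UNIV. z l * P $ l $ k * Q $ k $ i)"
      unfolding z(2)[of i, symmetric] by (simp add: matrix_matrix_mult_def sum_distrib_left mult.assoc)
    then show ?thesis
      by (subst (asm) sum.swap) (simp add: sum_distrib_right)
  qed
  define m where "m = Min (range (\<lambda>i. lam $ i / z i))"
  have "m \<in> range (\<lambda>i. lam $ i / z i)"
    unfolding m_def by (intro Min_in) auto
  then obtain i0 where i0: "m = lam $ i0 / z i0" by auto
  have m_le: "m \<le> lam $ i / z i" for i
    unfolding m_def by (intro Min_le) auto
  have m: "0 < m" unfolding i0 using lam z(1) by simp
  show ?thesis
  proof (rule that[of "\<lambda>i. m * z i"])
    show "0 < m * z i" for i using m z(1) by simp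
    show "m * z i = (\<Sum>k\<in>UNIV. (\<Sum>l\<in>UNIV. m * z l * P $ l $ k) * Q $ k $ i)" for i
      by (subst z_eq) (simp add: sum_distrib_left sum_distrib_right mult.assoc)
    show "m * z i \<le> lam $ i" for i
      using m_le[of i] z(1)[of i] by (simp add: pos_le_divide_eq)
    show "\<exists>i. m * z i = lam $ i"
      using z(1)[of i0] by (intro exI[of _ i0]) (simp add: i0)
  qed
qed

section \<open>Limit points and the distance to equilibrium\<close>

theorem theorem4:
  fixes lam :: "real^('r::finite)"
    and mu P Q :: "real^'r^'r"
    and e f :: "real \<Rightarrow> real^'r^'r"
    and u :: "real \<Rightarrow> real^'r"
    and \<epsilon> :: real
  assumes "\<And>i. lam $ i > 0"
    and "\<And>i j. mu $ i $ j > 0"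
    and "row_stochastic P"
    and "row_stochastic Q"
    and "\<And>i j. P $ i $ j > 0"
    and "\<And>i. Q $ i $ i > 0"
    and "(e 0, f 0) \<in> state_space"
    and "fluid_solution lam mu P Q e f u"
    and "\<epsilon> > 0"
  shows "\<exists>T>0. \<forall>t\<ge>T.
    (INF x\<in>equilibrium_set lam mu P Q. ereal (infnorm ((e t, f t) - x))) < ereal \<epsilon>"
proof -
  obtain x :: "'r \<Rightarrow> real" where x: "\<And>i. 0 < x i"
    "\<And>i. x i = (\<Sum>k\<in>UNIV. (\<Sum>l\<in>UNIV. x l * P $ l $ k) * Q $ k $ i)"
    "\<And>i. x i \<le> lam $ i" "\<exists>i. x i = lam $ i"
    using assms(1,3-6) by (rule scaled_stationary_vector) (rule that)
  interpret fluid_equilibrium "\<lambda>i. lam $ i" "\<lambda>i j. mu $ i $ j" "\<lambda>i j. P $ i $ j" "\<lambda>i j. Q $ i $ j"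
    "\<lambda>i j t. e t $ i $ j" "\<lambda>i j t. f t $ i $ j" "\<lambda>i t. lam $ i * (t - u t $ i)" x
    by (intro fluid_equilibrium.intro fluid_equilibrium_axioms.intro fluid_solution_flow assms x)
  \<comment> \<open>Every entry has a known limit except possibly queues with
    \<open>c * x i = lam $ i\<close>; there \<open>a $ i = 1\<close>, so complementarity puts no
    constraint on \<open>E $ i $ i\<close>.\<close>
  have limit_mem: "(E, G) \<in> equilibrium_set lam mu P Q"
    if s: "filterlim s at_top sequentially" and lim: "(\<lambda>n. (e (s n), f (s n))) \<longlonglongrightarrow> (E, G)" for s :: "nat \<Rightarrow> real" and E G
  proof -
    have eE: "(\<lambda>n. e (s n) $ i $ j) \<longlonglongrightarrow> E $ i $ j" for i j
      using tendsto_fst[OF lim] by (auto intro!: tendsto_vec_nth)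
    have fG: "(\<lambda>n. f (s n) $ i $ j) \<longlonglongrightarrow> G $ i $ j" for i j
      using tendsto_snd[OF lim] by (auto intro!: tendsto_vec_nth)
    have ev: "eventually (\<lambda>n. 0 \<le> s n) sequentially"
      using s by (simp add: filterlim_at_top)
    have G: "G $ i $ j = c * fs i j" for i j
      using LIMSEQ_unique[OF fG filterlim_compose[OF f_tendsto s]] .
    have E: "E $ i $ j = c * es i j" if "i \<noteq> j" for i j
      using LIMSEQ_unique[OF eE filterlim_compose[OF e_tendsto[OF that] s]] .
    have E0: "E $ i $ i = 0" if "c * x i < lam $ i" for i
      using LIMSEQ_unique[OF eE filterlim_compose[OF queue_tendsto[OF that] s]] .
    have "0 \<le> E $ i $ j" "E $ i $ j \<le> 1" "0 \<le> G $ i $ j" "G $ i $ j \<le> 1" for i j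
      by (rule tendsto_lowerbound[OF eE] tendsto_upperbound[OF eE] tendsto_lowerbound[OF fG] tendsto_upperbound[OF fG];
          use ev in \<open>auto elim!: eventually_mono simp: e_nonneg f_nonneg entry_le_1\<close>)+
    moreover have "(\<Sum>i\<in>UNIV. \<Sum>j\<in>UNIV. E $ i $ j + G $ i $ j) = 1"
    proof (rule LIMSEQ_unique)
      show "(\<lambda>n. \<Sum>i\<in>UNIV. \<Sum>j\<in>UNIV. e (s n) $ i $ j + f (s n) $ i $ j) \<longlonglongrightarrow> (\<Sum>i\<in>UNIV. \<Sum>j\<in>UNIV. E $ i $ j + G $ i $ j)"
        by (intro tendsto_intros eE fG)
      show "(\<lambda>n. \<Sum>i\<in>UNIV. \<Sum>j\<in>UNIV. e (s n) $ i $ j + f (s n) $ i $ j) \<longlonglongrightarrow> 1"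
        by (rule tendsto_eventually) (use ev in eventually_elim, rule mass)
    qed
    ultimately have "(E, G) \<in> state_space"
      by (simp add: state_space_def)
    moreover have "\<exists>a :: real^'r.
        (\<forall>i. 0 \<le> a $ i \<and> a $ i \<le> 1) \<and>
        (\<forall>i j. lam $ i * P $ i $ j * a $ i = mu $ i $ j * G $ i $ j) \<and>
        (\<forall>i j. i \<noteq> j \<longrightarrow> mu $ i $ j * E $ i $ j = Q $ i $ j * (\<Sum>k\<in>UNIV. mu $ k $ i * G $ k $ i)) \<and>
        (\<forall>i. lam $ i * a $ i = (\<Sum>k\<in>UNIV - {i}. mu $ k $ i * E $ k $ i)
             + Q $ i $ i * (\<Sum>k\<in>UNIV. mu $ k $ i * G $ k $ i)) \<and>
        (\<forall>i. (1 - a $ i) * E $ i $ i = 0)"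
    proof (intro exI[of _ "\<chi> i. c * x i / lam $ i"] conjI allI impI)
      fix i j
      have sum_G: "(\<Sum>k\<in>UNIV. mu $ k $ i * G $ k $ i) = c * y i"
        by (simp add: G sum_mu_fs[symmetric] sum_distrib_left mult_ac)
      have lam0: "lam $ i \<noteq> 0" using lam_pos[of i] by simp
      have cx: "0 \<le> c * x i" "c * x i \<le> lam $ i"
        using c_bounds x(1)[of i] kx_le_lam[of c i] by auto
      show "0 \<le> (\<chi> i. c * x i / lam $ i) $ i" "(\<chi> i. c * x i / lam $ i) $ i \<le> 1"
        using cx lam_pos[of i] by auto
      show "lam $ i * P $ i $ j * (\<chi> i. c * x i / lam $ i) $ i = mu $ i $ j * G $ i $ j"
        using lam0 mu_fs[of i j] by (simp add: G mult.left_commute)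
      show "mu $ i $ j * E $ i $ j = Q $ i $ j * (\<Sum>k\<in>UNIV. mu $ k $ i * G $ k $ i)" if "i \<noteq> j"
        using mu_es[OF that] by (simp add: E that sum_G mult.left_commute)
      have "(\<Sum>k\<in>UNIV - {i}. mu $ k $ i * E $ k $ i) = c * (\<Sum>k\<in>UNIV - {i}. mu $ k $ i * es k i)"
        by (simp add: E sum_distrib_left mult.left_commute)
      moreover have "lam $ i * (\<chi> i. c * x i / lam $ i) $ i = c * x i"
        using lam0 by simp
      ultimately show "lam $ i * (\<chi> i. c * x i / lam $ i) $ i = (\<Sum>k\<in>UNIV - {i}. mu $ k $ i * E $ k $ i)
             + Q $ i $ i * (\<Sum>k\<in>UNIV. mu $ k $ i * G $ k $ i)"
        unfolding sum_G x_balance[of i, symmetric] by (simp only: distrib_left mult.left_commute)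
      show "(1 - (\<chi> i. c * x i / lam $ i) $ i) * E $ i $ i = 0"
        using E0[of i] cx lam0 by (cases "c * x i = lam $ i") auto
    qed
    ultimately show ?thesis
      by (simp add: equilibrium_set_def)
  qed
  \<comment> \<open>Otherwise some times tending to infinity stay away from the set; by boundedness
    the states along them have a limit point, which \<open>limit_mem\<close> places in the
    set.\<close>
  have "eventually (\<lambda>t. (INF x\<in>equilibrium_set lam mu P Q. ereal (infnorm ((e t, f t) - x))) < ereal \<epsilon>) at_top"
  proof (rule ccontr)
    assume "\<not> ?thesis"
    then have "\<forall>n. \<exists>t\<ge>real n. \<not> (INF x\<in>equilibrium_set lam mu P Q. ereal (infnorm ((e t, f t) - x))) < ereal \<epsilon>"
      by (auto simp: eventually_at_top_linorder)
    then obtain s where s: "\<And>n. real n \<le> s n"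
      and far: "\<And>n. \<not> (INF x\<in>equilibrium_set lam mu P Q. ereal (infnorm ((e (s n), f (s n)) - x))) < ereal \<epsilon>"
      by metis
    have s0: "0 \<le> s n" for n using s[of n] by linarith
    have bdd: "norm (z :: real^'r^'r) \<le> real CARD('r) * real CARD('r)" if "\<And>i j. \<bar>z $ i $ j\<bar> \<le> 1" for z
    proof -
      have "norm (z $ i) \<le> real CARD('r)" for i
        using order.trans[OF norm_le_l1_cart[of "z $ i"] sum_bounded_above[of UNIV "\<lambda>j. \<bar>z $ i $ j\<bar>" 1]] that by simp
      then show ?thesis
        unfolding norm_vec_def[of z]
        using order.trans[OF L2_set_le_sum[of UNIV "\<lambda>i. norm (z $ i)"] sum_bounded_above[of UNIV "\<lambda>i. norm (z $ i)" "real CARD('r)"]] by simp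
    qed
    have "bounded (range (\<lambda>n. (e (s n), f (s n))))"
    proof (rule bounded_subset)
      show "bounded (cball (0::real^'r^'r) (real CARD('r) * real CARD('r)) \<times> cball (0::real^'r^'r) (real CARD('r) * real CARD('r)))"
        by (intro bounded_Times bounded_cball)
      show "range (\<lambda>n. (e (s n), f (s n))) \<subseteq> cball 0 (real CARD('r) * real CARD('r)) \<times> cball 0 (real CARD('r) * real CARD('r))"
        using s0 e_nonneg f_nonneg entry_le_1 by (auto intro!: bdd simp: abs_le_iff)
    qed
    then obtain l r where r: "strict_mono r" and lim: "((\<lambda>n. (e (s n), f (s n))) \<circ> r) \<longlonglongrightarrow> l"
      using bounded_imp_convergent_subsequence by blast
    have "filterlim s at_top sequentially"
      by (rule filterlim_at_top_mono[OF filterlim_real_sequentially]) (use s in auto)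
    then have "filterlim (\<lambda>n. s (r n)) at_top sequentially"
      by (rule filterlim_compose[OF _ filterlim_subseq[OF r]])
    then have l: "l \<in> equilibrium_set lam mu P Q"
      using limit_mem[of "\<lambda>n. s (r n)" "fst l" "snd l"] lim by (simp add: o_def)
    have "(\<lambda>n. norm ((e (s (r n)), f (s (r n))) - l)) \<longlonglongrightarrow> 0"
      using lim by (intro tendsto_norm_zero LIM_zero) (simp add: o_def)
    then have "eventually (\<lambda>n. norm ((e (s (r n)), f (s (r n))) - l) < \<epsilon>) sequentially"
      using assms(9) by (rule order_tendstoD)
    then obtain n where n: "norm ((e (s (r n)), f (s (r n))) - l) < \<epsilon>"
      by (auto simp: eventually_sequentially)
    have "(INF x\<in>equilibrium_set lam mu P Q. ereal (infnorm ((e (s (r n)), f (s (r n))) - x)))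
      \<le> ereal (infnorm ((e (s (r n)), f (s (r n))) - l))"
      by (rule INF_lower[OF l])
    also have "\<dots> < ereal \<epsilon>"
      using n infnorm_le_norm[of "(e (s (r n)), f (s (r n))) - l"] by simp
    finally show False using far by blast
  qed
  then obtain T where T: "\<forall>t\<ge>T. (INF x\<in>equilibrium_set lam mu P Q. ereal (infnorm ((e t, f t) - x))) < ereal \<epsilon>"
    by (auto simp: eventually_at_top_linorder)
  then show ?thesis
    by (intro exI[of _ "max 1 T"]) auto
qed

end
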